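(* Let $X$ be a two-dimensional real normed space whose unit ball $BX$ is a polygon with finitely many sides, and suppose that there is no coordinate system in $X$ in which the slopes of all sides of $BX$ are algebraic. Then for any well-distributed set $S\subset X$ there is a constant $c>0$ (which may depend on $X$ and $S$) such that $$|\Delta_{X,N}(S)|\ge c\,\frac{N\log N}{\log\log N}\quad\text{for all integers } N\ge 3.$$
   Context: $X$ denotes $\mathbb{R}^2$ equipped with a norm $\|\cdot\|_X$, and $BX=\{x:\|x\|_X\le 1\}$. A coordinate system in $X$ is given by two non-collinear vectors $e_1,e_2\in X$, the coordinates $(x_1,x_2)$ of $x\in X$ being determined by $x=x_1e_1+x_2e_2$. For a non-degenerate segment $I\subset X$ contained in the line $u_1x_1+u_2x_2+u_0=0$, its slope (in this coordinate system) is $-u_1/u_2$, or $\infty$ if $u_2=0$; by convention $\infty$ is considered to be an algebraic number. "Algebraic" means algebraic over $\mathbb{Q}$. A set $S\subset X$ is well-distributed if there is a constant $K$ such that for every $x\in X$ there is $y\in S$ with $\|x-y\|_X\le K$. For a positive integer $N$ and $A\subset X$, $\Delta_{X,N}(A)$ is the set of all numbers $\|a-a'\|_X$ with $a,a'\in A$ and $\|a-a'\|_X\le N$; $|\cdot|$ denotes cardinality (possibly $\infty$). *)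

theory Defs
  imports "HOL-Analysis.Analysis" "HOL-Computational_Algebra.Computational_Algebra"
begin

text \<open>
  The plane with a norm \<open>nrm\<close> is \<^typ>\<open>real ^ 2\<close> together with an explicit function,
  because \<^const>\<open>norm\<close> on this type is fixed to be the Euclidean norm.
\<close>

definition is_norm :: "(real ^ 2 \<Rightarrow> real) \<Rightarrow> bool" where
  "is_norm nrm \<longleftrightarrow>
     (\<forall>x. nrm x = 0 \<longleftrightarrow> x = 0) \<and>
     (\<forall>a x. nrm (a *\<^sub>R x) = \<bar>a\<bar> * nrm x) \<and>
     (\<forall>x y. nrm (x + y) \<le> nrm x + nrm y)"

definition unit_ball :: "(real ^ 2 \<Rightarrow> real) \<Rightarrow> (real ^ 2) set" where
  "unit_ball nrm = {x. nrm x \<le> 1}"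

text \<open>For a polygon with non-empty interior the facets have affine dimension 1.\<close>

definition sides :: "(real ^ 2) set \<Rightarrow> (real ^ 2) set set" where
  "sides P = {F. F facet_of P}"

definition coordinate_system :: "real ^ 2 \<Rightarrow> real ^ 2 \<Rightarrow> bool" where
  "coordinate_system e1 e2 \<longleftrightarrow> \<not> collinear {0, e1, e2}"

definition coord_line :: "real ^ 2 \<Rightarrow> real ^ 2 \<Rightarrow> real \<Rightarrow> real \<Rightarrow> real \<Rightarrow> (real ^ 2) set" where
  "coord_line e1 e2 u1 u2 u0 =
     {x1 *\<^sub>R e1 + x2 *\<^sub>R e2 | x1 x2. u1 * x1 + u2 * x2 + u0 = 0}"

definition has_slope :: "real ^ 2 \<Rightarrow> real ^ 2 \<Rightarrow> (real ^ 2) set \<Rightarrow> ereal \<Rightarrow> bool" where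
  "has_slope e1 e2 I s \<longleftrightarrow>
     (\<exists>u1 u2 u0. (u1 \<noteq> 0 \<or> u2 \<noteq> 0) \<and> I \<subseteq> coord_line e1 e2 u1 u2 u0 \<and>
        s = (if u2 = 0 then \<infinity> else ereal (- u1 / u2)))"

definition slope :: "real ^ 2 \<Rightarrow> real ^ 2 \<Rightarrow> (real ^ 2) set \<Rightarrow> ereal" where
  "slope e1 e2 I = (THE s. has_slope e1 e2 I s)"

definition algebraic_slope :: "ereal \<Rightarrow> bool" where
  "algebraic_slope s \<longleftrightarrow> s = \<infinity> \<or> (\<exists>r. s = ereal r \<and> algebraic r)"

lemma coordinates_unique:
  assumes "coordinate_system e1 e2"
    and "x1 *\<^sub>R e1 + x2 *\<^sub>R e2 = y1 *\<^sub>R e1 + y2 *\<^sub>R e2"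
  shows "x1 = y1 \<and> x2 = y2"
proof -
  have eq: "(x1 - y1) *\<^sub>R e1 = (y2 - x2) *\<^sub>R e2"
    using assms(2) by (simp add: algebra_simps)
  have nc: "e1 \<noteq> 0" "e2 \<noteq> 0" "\<And>c. e2 \<noteq> c *\<^sub>R e1"
    using assms(1) unfolding coordinate_system_def collinear_lemma by auto
  have "x2 = y2"
  proof (rule ccontr)
    assume "x2 \<noteq> y2"
    hence "e2 = (1 / (y2 - x2)) *\<^sub>R ((y2 - x2) *\<^sub>R e2)" by simp
    also have "\<dots> = ((x1 - y1) / (y2 - x2)) *\<^sub>R e1" by (simp flip: eq)
    finally show False using nc(3) by blast
  qed
  with eq nc(1) show ?thesis by simp
qed

lemma has_slope_unique:
  assumes cs: "coordinate_system e1 e2" and pq: "p \<in> I" "q \<in> I" "p \<noteq> q"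
    and s: "has_slope e1 e2 I s" and t: "has_slope e1 e2 I t"
  shows "s = t"
proof -
  obtain u1 u2 u0 where u: "u1 \<noteq> 0 \<or> u2 \<noteq> 0" "I \<subseteq> coord_line e1 e2 u1 u2 u0"
    "s = (if u2 = 0 then \<infinity> else ereal (- u1 / u2))"
    using s unfolding has_slope_def by blast
  obtain v1 v2 v0 where v: "v1 \<noteq> 0 \<or> v2 \<noteq> 0" "I \<subseteq> coord_line e1 e2 v1 v2 v0"
    "t = (if v2 = 0 then \<infinity> else ereal (- v1 / v2))"
    using t unfolding has_slope_def by blast
  obtain p1 p2 where p: "p = p1 *\<^sub>R e1 + p2 *\<^sub>R e2" "u1 * p1 + u2 * p2 + u0 = 0"
    using u(2) pq(1) unfolding coord_line_def by blast
  obtain q1 q2 where q: "q = q1 *\<^sub>R e1 + q2 *\<^sub>R e2" "u1 * q1 + u2 * q2 + u0 = 0"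
    using u(2) pq(2) unfolding coord_line_def by blast
  have p': "v1 * p1 + v2 * p2 + v0 = 0"
    using v(2) pq(1) p(1) coordinates_unique[OF cs] unfolding coord_line_def by blast
  have q': "v1 * q1 + v2 * q2 + v0 = 0"
    using v(2) pq(2) q(1) coordinates_unique[OF cs] unfolding coord_line_def by blast
  define d1 d2 where "d1 = p1 - q1" and "d2 = p2 - q2"
  have d: "d1 \<noteq> 0 \<or> d2 \<noteq> 0" using pq(3) p(1) q(1) by (auto simp: d1_def d2_def)
  have eu: "u1 * d1 + u2 * d2 = 0" using p(2) q(2) by (simp add: d1_def d2_def algebra_simps)
  have ev: "v1 * d1 + v2 * d2 = 0" using p' q' by (simp add: d1_def d2_def algebra_simps)
  have "d1 * (u1 * v2 - u2 * v1) = v2 * (u1 * d1 + u2 * d2) - u2 * (v1 * d1 + v2 * d2)"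
    "d2 * (u1 * v2 - u2 * v1) = u1 * (v1 * d1 + v2 * d2) - v1 * (u1 * d1 + u2 * d2)"
    by (simp_all add: algebra_simps)
  hence "u1 * v2 = u2 * v1" using d eu ev by auto
  with u(1,3) v(1,3) show ?thesis by (auto simp: field_simps)
qed

lemma slope_eq:
  assumes "coordinate_system e1 e2" and "p \<in> I" "q \<in> I" "p \<noteq> q" and "has_slope e1 e2 I s"
  shows "slope e1 e2 I = s"
  unfolding slope_def using assms(5) has_slope_unique[OF assms(1-4)] by blast

definition well_distributed :: "(real ^ 2 \<Rightarrow> real) \<Rightarrow> (real ^ 2) set \<Rightarrow> bool" where
  "well_distributed nrm S \<longleftrightarrow> (\<exists>K. \<forall>x. \<exists>y\<in>S. nrm (x - y) \<le> K)"

definition distance_set :: "(real ^ 2 \<Rightarrow> real) \<Rightarrow> nat \<Rightarrow> (real ^ 2) set \<Rightarrow> real set" where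
  "distance_set nrm N A = {nrm (a - a') | a a'. a \<in> A \<and> a' \<in> A \<and> nrm (a - a') \<le> real N}"

text \<open>\<^const>\<open>card\<close> is 0 on infinite sets, whereas the distance set may well be infinite.\<close>

definition ecard :: "'a set \<Rightarrow> ereal" where
  "ecard A = (if finite A then ereal (real (card A)) else \<infinity>)"

end

theory Submission
  imports Defs
begin

text \<open>
  A transcendental cross ratio gives four sides whose linear forms are, up to scaling,
  \<open>x\<close>, \<open>y\<close>, \<open>x + y\<close> and \<open>x + \<alpha> y\<close> with \<open>\<alpha>\<close> transcendental. In the direction of each of these
  sides the norm is a multiple of the corresponding form, so the number \<open>D\<close> of distances bounds
  the differences of values of all four forms on a piece of \<open>S\<close> of size about \<open>N \<times> N\<close>.
  Put \<open>l = D / N\<close>. By Freiman's dimension lemma the values of \<open>x\<close> and \<open>y\<close> lie in a rational space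
  \<open>V\<close> of dimension \<open>O(l)\<close>. Horizontal and vertical slices give sets \<open>X\<close>, \<open>Y\<close> of size at least
  \<open>N\<close> over a power of \<open>l\<close> for which \<open>X - Y\<close> and \<open>X - \<alpha> Y\<close> have size at most \<open>N\<close> times a power
  of \<open>l\<close>. Intersecting \<open>V\<close> repeatedly with its dilates by \<open>1 / \<alpha>\<close> reaches \<open>0\<close> after \<open>O(l)\<close> steps,
  each of which costs a power of \<open>l\<close>. Hence \<open>N\<close> is at most \<open>l\<close> to the power \<open>O(l)\<close>.
\<close>

subsection \<open>Difference sets and rational dimension\<close>

definition diff_set :: "real set \<Rightarrow> real set \<Rightarrow> real set" where
  "diff_set A B = (\<lambda>(a, b). a - b) ` (A \<times> B)"

lemma diff_setI: "a \<in> A \<Longrightarrow> b \<in> B \<Longrightarrow> a - b \<in> diff_set A B"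
  unfolding diff_set_def by force

lemma diff_setE:
  assumes "x \<in> diff_set A B"
  obtains a b where "a \<in> A" "b \<in> B" "x = a - b"
  using assms unfolding diff_set_def by auto

lemma finite_diff_set [simp]: "finite A \<Longrightarrow> finite B \<Longrightarrow> finite (diff_set A B)"
  unfolding diff_set_def by simp

lemma diff_set_mono: "A \<subseteq> A' \<Longrightarrow> B \<subseteq> B' \<Longrightarrow> diff_set A B \<subseteq> diff_set A' B'"
  unfolding diff_set_def by blast

lemma diff_set_swap: "diff_set B A = uminus ` diff_set A B"
  unfolding diff_set_def by force

lemma card_diff_set_swap: "card (diff_set B A) = card (diff_set A B)"
  unfolding diff_set_swap[of B A] by (simp add: card_image)

lemma card_le_card_diff_set:
  assumes "finite A" "finite B"
  shows "B \<noteq> {} \<Longrightarrow> card A \<le> card (diff_set A B)"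
    and "A \<noteq> {} \<Longrightarrow> card B \<le> card (diff_set A B)"
proof -
  show "card A \<le> card (diff_set A B)" if "B \<noteq> {}"
  proof -
    from that obtain b where "b \<in> B" by blast
    thus ?thesis using assms
      by (intro card_inj_on_le[where f = "\<lambda>a. a - b"]) (auto intro: diff_setI simp: inj_on_def)
  qed
  show "card B \<le> card (diff_set A B)" if "A \<noteq> {}"
  proof -
    from that obtain a where "a \<in> A" by blast
    thus ?thesis using assms
      by (intro card_inj_on_le[where f = "\<lambda>b. a - b"]) (auto intro: diff_setI simp: inj_on_def)
  qed
qed

text \<open>Ruzsa's triangle inequality. Once a representation \<open>x = l x - r x\<close> is fixed
  for every \<open>x\<close>, the pair \<open>(l x - b, b - r x)\<close> determines \<open>x\<close>
  as the sum of its entries, and then \<open>b\<close>.\<close>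

lemma ruzsa_triangle:
  assumes "finite A" "finite B" "finite C"
  shows "card (diff_set A C) * card B \<le> card (diff_set A B) * card (diff_set B C)"
proof -
  have "\<forall>x. \<exists>a c. x \<in> diff_set A C \<longrightarrow> a \<in> A \<and> c \<in> C \<and> x = a - c"
    by (meson diff_setE)
  then obtain l r where lr: "\<And>x. x \<in> diff_set A C \<Longrightarrow> l x \<in> A \<and> r x \<in> C \<and> x = l x - r x"
    by metis
  have "card (diff_set A C \<times> B) \<le> card (diff_set A B \<times> diff_set B C)"
  proof (rule card_inj_on_le)
    show "inj_on (\<lambda>(x, b). (l x - b, b - r x)) (diff_set A C \<times> B)"
    proof (rule inj_onI, clarify)
      fix x b x' b'
      assume x: "x \<in> diff_set A C" "x' \<in> diff_set A C"
        and eq: "l x - b = l x' - b'" "b - r x = b' - r x'"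
      from eq have "l x - r x = l x' - r x'" by simp
      with lr x have "x = x'" by metis
      with eq show "x = x' \<and> b = b'" by simp
    qed
  qed (use assms lr in \<open>auto intro: diff_setI\<close>)
  thus ?thesis by (simp add: card_cartesian_product)
qed

interpretation rat_vs: vector_space "\<lambda>(q::rat) (x::real). of_rat q * x"
  by unfold_locales (simp_all add: algebra_simps of_rat_add of_rat_mult)

text \<open>
  Splitting a positive number as \<open>g + h\<close> makes it smaller, so repeated splitting ends.
\<close>

lemma span_indecomposables:
  fixes G H :: "real set"
  assumes "finite G" "finite H" and pos: "\<And>x. x \<in> G \<union> H \<Longrightarrow> x > 0"
  shows "G \<union> H \<subseteq> rat_vs.span {x \<in> G \<union> H. \<not> (\<exists>g\<in>G. \<exists>h\<in>H. x = g + h)}" 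
    (is "_ \<subseteq> rat_vs.span ?I")
proof (rule ccontr)
  assume not_sub: "\<not> G \<union> H \<subseteq> rat_vs.span ?I"
  define bad where "bad = {x \<in> G \<union> H. x \<notin> rat_vs.span ?I}"
  have fin: "finite bad" and ne: "bad \<noteq> {}"
    using assms(1,2) not_sub by (auto simp: bad_def)
  define m where "m = Min bad"
  have m: "m \<in> bad" using fin ne by (simp add: m_def)
  hence "m \<notin> ?I" using rat_vs.span_base[of m ?I] unfolding bad_def by blast
  with m obtain g h where gh: "g \<in> G" "h \<in> H" "m = g + h" by (auto simp: bad_def)
  have "g > 0" "h > 0" using pos gh by auto
  have "g \<notin> bad" "h \<notin> bad"
    using Min_le[OF fin, of g] Min_le[OF fin, of h] \<open>g > 0\<close> \<open>h > 0\<close> gh(3) by (auto simp: m_def)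
  hence "g \<in> rat_vs.span ?I" "h \<in> rat_vs.span ?I" using gh by (auto simp: bad_def)
  hence "m \<in> rat_vs.span ?I" unfolding gh(3) by (rule rat_vs.span_add)
  with m show False by (simp add: bad_def)
qed

text \<open>
  A form of Freiman's dimension lemma: every time the largest element of \<open>A\<close> and the smallest
  element of \<open>B\<close> are removed, more than \<open>d\<close> differences disappear.
\<close>

lemma freiman_dimension:
  fixes A B B0 :: "real set"
  assumes "finite A" "finite B" "n \<le> card A" "n \<le> card {b \<in> B. \<forall>x\<in>B0. b < x}"
    and "B0 \<subseteq> B" "b0 \<in> B0"
    and nospan: "\<not> (\<exists>T. finite T \<and> card T \<le> d \<and> (\<forall>x\<in>B0. x - b0 \<in> rat_vs.span T))"
  shows "n * (d + 1) \<le> card (diff_set A B)"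
  using assms(1-5)
proof (induction n arbitrary: A B)
  case 0
  show ?case by simp
next
  case (Suc n)
  note fin = Suc.prems(1,2)
  define L where "L = {b \<in> B. \<forall>x\<in>B0. b < x}"
  have "A \<noteq> {}" using Suc.prems(3) by auto
  have "L \<noteq> {}" using Suc.prems(4) unfolding L_def by force
  then obtain l where l: "l \<in> B" "\<forall>x\<in>B0. l < x" by (auto simp: L_def)
  have "B \<noteq> {}" using l(1) by auto
  define a b where "a = Max A" and "b = Min B"
  have a: "a \<in> A" "\<And>x. x \<in> A \<Longrightarrow> x \<le> a" using fin(1) \<open>A \<noteq> {}\<close> by (auto simp: a_def)
  have b: "b \<in> B" "\<And>x. x \<in> B \<Longrightarrow> b \<le> x" using fin(2) \<open>B \<noteq> {}\<close> by (auto simp: b_def)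
  \<comment> \<open>The minimum of \<open>B\<close> lies below all of \<open>B0\<close>. Deleting it
    keeps \<open>B0\<close> inside \<open>B'\<close> and uses up just one of the reserve elements in
    \<open>L\<close>.\<close>
  have bL: "b \<in> L" using b l by (auto simp: L_def intro: le_less_trans)
  hence "b \<notin> B0" by (auto simp: L_def)
  define A' B' where "A' = A - {a}" and "B' = B - {b}"
  have "{b \<in> B'. \<forall>x\<in>B0. b < x} = L - {b}" by (auto simp: L_def B'_def)
  moreover have "finite L" using fin by (simp add: L_def)
  ultimately have "n * (d + 1) \<le> card (diff_set A' B')"
    using Suc.prems bL a(1) \<open>b \<notin> B0\<close>
    by (intro Suc.IH) (auto simp: A'_def B'_def L_def[symmetric] card_Diff_singleton)
  \<comment> \<open>\<open>G\<close> and \<open>H\<close> hold the positive gaps to the two deleted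
    extremes. Gaps that are no sum of one element from each give differences that really
    disappear.\<close>
  define G H where "G = (\<lambda>x. a - x) ` A'" and "H = (\<lambda>x. x - b) ` B'"
  define I where "I = {x \<in> G \<union> H. \<not> (\<exists>g\<in>G. \<exists>h\<in>H. x = g + h)}"
  have finGH: "finite G" "finite H" using fin by (auto simp: G_def H_def A'_def B'_def)
  have pos: "x > 0" if "x \<in> G \<union> H" for x
    using that a(2) b(2) by (fastforce simp: G_def H_def A'_def B'_def)
  have sub: "G \<union> H \<subseteq> rat_vs.span I"
    unfolding I_def using finGH pos by (rule span_indecomposables)
  have finI: "finite I" using finGH by (simp add: I_def)
  have "x - b0 \<in> rat_vs.span I" if "x \<in> B0" for x
  proof -
    have "x - b \<in> rat_vs.span I" "b0 - b \<in> rat_vs.span I"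
      using that assms(6) Suc.prems(5) \<open>b \<notin> B0\<close> sub by (auto simp: H_def B'_def)
    from rat_vs.span_diff[OF this] show ?thesis by simp
  qed
  hence cardI: "d + 1 \<le> card I" using nospan finI by (metis not_less_eq_eq Suc_eq_plus1)
  define E where "E = (\<lambda>i. a - b - i) ` I"
  have "card E = card I" unfolding E_def by (rule card_image) (auto simp: inj_on_def)
  have E1: "E \<subseteq> diff_set A B"
  proof
    fix e assume "e \<in> E"
    then obtain i where i: "i \<in> G \<union> H" "e = a - b - i" by (auto simp: E_def I_def)
    thus "e \<in> diff_set A B"
    proof (elim UnE)
      assume "i \<in> G"
      then obtain x where "x \<in> A" "i = a - x" by (auto simp: G_def A'_def)
      hence "x \<in> A" "e = x - b" using i(2) by simp_all
      thus ?thesis using b(1) by (auto intro: diff_setI)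
    next
      assume "i \<in> H"
      then obtain x where "x \<in> B" "i = x - b" by (auto simp: H_def B'_def)
      hence "x \<in> B" "e = a - x" using i(2) by simp_all
      thus ?thesis using a(1) by (auto intro: diff_setI)
    qed
  qed
  have E2: "E \<inter> diff_set A' B' = {}"
  proof (rule ccontr)
    assume "E \<inter> diff_set A' B' \<noteq> {}"
    then obtain i where i: "i \<in> I" "a - b - i \<in> diff_set A' B'" by (auto simp: E_def)
    then obtain x y where xy: "x \<in> A'" "y \<in> B'" "a - b - i = x - y" by (elim diff_setE)
    hence "i = (a - x) + (y - b)" "a - x \<in> G" "y - b \<in> H" by (auto simp: G_def H_def)
    with i(1) show False by (auto simp: I_def)
  qed
  have "diff_set A' B' \<subseteq> diff_set A B" by (rule diff_set_mono) (auto simp: A'_def B'_def)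
  have "card (diff_set A' B') + card E = card (diff_set A' B' \<union> E)"
    using E2 fin finI by (subst card_Un_disjoint) (auto simp: A'_def B'_def E_def)
  also have "\<dots> \<le> card (diff_set A B)"
    using E1 \<open>diff_set A' B' \<subseteq> diff_set A B\<close> fin by (intro card_mono) auto
  finally show ?case using \<open>n * (d + 1) \<le> card (diff_set A' B')\<close> cardI \<open>card E = card I\<close> by simp
qed

text \<open>
  All pairs \<open>(x, y)\<close> with \<open>x\<close> in a fixed coset and a given difference have \<open>y\<close> in one coset.
\<close>

lemma coset_counting:
  fixes X Y H :: "real set"
  assumes "finite X" "finite Y" "Y \<noteq> {}" and H: "\<And>u v. u \<in> H \<Longrightarrow> v \<in> H \<Longrightarrow> u - v \<in> H"
  obtains c where "c \<in> Y"
    "card Y * card {x \<in> X. x - c0 \<in> H} \<le> card (diff_set X Y) * card {y \<in> Y. y - c \<in> H}"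
proof -
  define m where "m = (\<lambda>c. card {y \<in> Y. y - c \<in> H})"
  have "Max (m ` Y) \<in> m ` Y" using assms(2,3) by simp
  then obtain c where "c \<in> Y" "m c = Max (m ` Y)" by force
  hence c: "c \<in> Y" "\<And>y. y \<in> Y \<Longrightarrow> m y \<le> m c" using assms(2) by auto
  define X' where "X' = {x \<in> X. x - c0 \<in> H}"
  have X'_diff: "x - x' \<in> H" if "x \<in> X'" "x' \<in> X'" for x x'
    using H[of "x - c0" "x' - c0"] that by (simp add: X'_def)
  define P where "P = (\<lambda>v. {p \<in> X' \<times> Y. fst p - snd p = v})"
  have fin: "finite X'" using assms(1) by (simp add: X'_def)
  have "card (P v) \<le> m c" for v
  proof (cases "P v = {}")
    case False
    then obtain x0 y0 where 0: "x0 \<in> X'" "y0 \<in> Y" "x0 - y0 = v" by (auto simp: P_def)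
    have "card (P v) \<le> m y0" unfolding m_def
    proof (rule card_inj_on_le)
      show "inj_on snd (P v)" by (auto simp: inj_on_def P_def)
      show "snd ` P v \<subseteq> {y \<in> Y. y - y0 \<in> H}"
      proof clarify
        fix x y assume "(x, y) \<in> P v"
        hence "x \<in> X'" "y \<in> Y" "y - y0 = x - x0" using 0 by (auto simp: P_def)
        thus "snd (x, y) \<in> Y \<and> snd (x, y) - y0 \<in> H" using X'_diff 0 by simp
      qed
    qed (use assms(2) in simp)
    also have "\<dots> \<le> m c" by (rule c(2)) fact
    finally show ?thesis .
  qed simp
  have "X' \<times> Y \<subseteq> (\<Union>v\<in>diff_set X Y. P v)"
    by (auto simp: P_def X'_def intro: diff_setI)
  moreover have "finite (\<Union>v\<in>diff_set X Y. P v)"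
    using fin assms(1,2) by (auto simp: P_def)
  ultimately have "card (X' \<times> Y) \<le> card (\<Union>v\<in>diff_set X Y. P v)" by (rule card_mono[rotated])
  also have "\<dots> \<le> (\<Sum>v\<in>diff_set X Y. card (P v))"
    using assms(1,2) by (intro card_UN_le) simp
  also have "\<dots> \<le> card (diff_set X Y) * m c"
    using sum_bounded_above[of "diff_set X Y" "\<lambda>v. card (P v)" "m c"] \<open>\<And>v. card (P v) \<le> m c\<close> by simp
  finally have "card Y * card X' \<le> card (diff_set X Y) * m c"
    by (simp add: card_cartesian_product mult.commute)
  thus ?thesis using that c(1) by (simp add: m_def X'_def)
qed

section \<open>Dilates by a transcendental number\<close>

text \<open>The \<open>d + 1\<close> numbers \<open>\<alpha> ^ i * u\<close> lie in a rational space
  of dimension at most \<open>d\<close>, so they are dependent. Dividing a dependence by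
  \<open>u\<close> gives a nonzero rational polynomial with root \<alpha>.\<close>

lemma algebraic_if_powers_in_span:
  fixes \<alpha> u :: real
  assumes T: "finite T" "card T \<le> d" and "u \<noteq> 0"
    and span: "\<And>i. i \<le> d \<Longrightarrow> \<alpha> ^ i * u \<in> rat_vs.span T"
  shows "algebraic \<alpha>"
proof (rule ccontr)
  assume nonalg: "\<not> algebraic \<alpha>"
  have zero: "c i = 0" if "(\<Sum>i\<le>d. of_rat (c i) * \<alpha> ^ i) = 0" "i \<le> d" for c :: "nat \<Rightarrow> rat" and i
  proof (rule ccontr)
    assume "c i \<noteq> 0"
    define p where "p = (\<Sum>i\<le>d. monom (real_of_rat (c i)) i)"
    have coeff: "coeff p k = (if k \<le> d then of_rat (c k) else 0)" for k
      by (simp add: p_def coeff_sum if_distrib cong: if_cong)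
    have "\<forall>k. coeff p k \<in> \<rat>" by (simp add: coeff)
    moreover have "p \<noteq> 0" using coeff[of i] \<open>c i \<noteq> 0\<close> that(2) by auto
    moreover have "poly p \<alpha> = 0" using that(1) by (simp add: p_def poly_sum poly_monom)
    ultimately show False using nonalg unfolding algebraic_altdef by blast
  qed
  define f where "f = (\<lambda>i. \<alpha> ^ i * u)"
  \<comment> \<open>Independence concerns the image as a set, so coinciding powers have to be
    excluded first; they would make \<alpha> a root of \<open>X ^ i - X ^ j\<close>.\<close>
  have inj: "inj_on f {..d}"
  proof (rule inj_onI)
    fix i j assume ij: "i \<in> {..d}" "j \<in> {..d}" and "f i = f j"
    hence eq: "\<alpha> ^ i = \<alpha> ^ j" using \<open>u \<noteq> 0\<close> by (simp add: f_def)
    show "i = j"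
    proof (rule ccontr)
      assume "i \<noteq> j"
      define c :: "nat \<Rightarrow> rat" where "c = (\<lambda>k. (if k = i then 1 else 0) - (if k = j then 1 else 0))"
      have "(\<Sum>k\<le>d. of_rat (c k) * \<alpha> ^ k)
          = (\<Sum>k\<le>d. (if k = i then \<alpha> ^ k else 0) - (if k = j then \<alpha> ^ k else 0))"
        by (rule sum.cong) (auto simp: c_def)
      also have "\<dots> = 0" using ij eq by (simp add: sum_subtractf)
      finally have "c i = 0" using zero ij by simp
      thus False using \<open>i \<noteq> j\<close> by (simp add: c_def)
    qed
  qed
  have "rat_vs.independent (f ` {..d})"
  proof (rule rat_vs.independent_if_scalars_zero)
    fix q :: "real \<Rightarrow> rat" and x
    assume "(\<Sum>x\<in>f ` {..d}. of_rat (q x) * x) = 0" and x: "x \<in> f ` {..d}"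
    hence "(\<Sum>i\<le>d. of_rat (q (f i)) * f i) = 0" using inj by (simp add: sum.reindex)
    hence "u * (\<Sum>i\<le>d. of_rat (q (f i)) * \<alpha> ^ i) = 0"
      by (simp add: f_def sum_distrib_left algebra_simps)
    hence "(\<Sum>i\<le>d. of_rat (q (f i)) * \<alpha> ^ i) = 0" using \<open>u \<noteq> 0\<close> by simp
    from zero[of "q \<circ> f"] this x show "q x = 0" by auto
  qed simp
  moreover have "f ` {..d} \<subseteq> rat_vs.span T" using span by (auto simp: f_def)
  ultimately have "card (f ` {..d}) \<le> card T"
    using rat_vs.independent_span_bound[OF T(1)] by blast
  thus False using T(2) inj by (simp add: card_image)
qed

text \<open>
  Descent along \<open>V j = {v. \<forall>i\<le>j. \<alpha>\<^sup>i v \<in> V}\<close>. Since \<open>\<alpha> v \<in> V j\<close> and \<open>v \<in> V\<close> give \<open>v \<in> V (j + 1)\<close>,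
  each step loses only a bounded factor in the largest number of points of \<open>X\<close> in a coset of
  \<open>V j\<close>, and \<open>V d = 0\<close> as \<open>\<alpha>\<close> is transcendental.
\<close>

lemma transcendental_dilate_bound:
  fixes X Y T :: "real set"
  assumes nonalg: "\<not> algebraic \<alpha>" and fin: "finite X" "finite Y" and ne: "X \<noteq> {}" "Y \<noteq> {}"
    and T: "finite T" "card T \<le> d"
    and XT: "\<And>x x'. x \<in> X \<Longrightarrow> x' \<in> X \<Longrightarrow> x - x' \<in> rat_vs.span T"
    and YT: "\<And>y y'. y \<in> Y \<Longrightarrow> y' \<in> Y \<Longrightarrow> y - y' \<in> rat_vs.span T"
  shows "card X * (card X * card Y) ^ d
       \<le> (card (diff_set X ((*) \<alpha> ` Y)) * card (diff_set X Y)) ^ d"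
proof -
  define V where "V = (\<lambda>j::nat. {v. \<forall>i\<le>j. \<alpha> ^ i * v \<in> rat_vs.span T})"
  have Vdiff: "u - v \<in> V j" if "u \<in> V j" "v \<in> V j" for u v j
    using that rat_vs.span_diff by (auto simp: V_def right_diff_distrib)
  \<comment> \<open>The power \<open>0\<close> asks for \<open>v\<close> in the span of
    \<open>T\<close>; the powers from \<open>1\<close> to \<open>j + 1\<close> ask for
    \<open>\<alpha> * v\<close> in \<open>V j\<close>.\<close>
  have VSuc: "v \<in> V (Suc j)" if "v \<in> rat_vs.span T" "\<alpha> * v \<in> V j" for v j
    unfolding V_def
  proof (clarify)
    fix i assume "i \<le> Suc j"
    thus "\<alpha> ^ i * v \<in> rat_vs.span T"
      using that by (cases i) (auto simp: V_def mult_ac)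
  qed
  define p q where "p = card (diff_set X ((*) \<alpha> ` Y))" and "q = card (diff_set X Y)"
  have "\<alpha> \<noteq> 0" using nonalg by auto
  hence inj: "inj_on ((*) \<alpha>) Z" for Z by (auto simp: inj_on_def)
  \<comment> \<open>In some coset of \<open>V j\<close> the set \<open>X\<close> retains at least a
    proportion \<open>(card X * card Y / (p * q)) ^ j\<close> of its points.\<close>
  have "\<exists>c\<in>X. card X * (card X * card Y) ^ j \<le> (p * q) ^ j * card {x \<in> X. x - c \<in> V j}" for j
  proof (induction j)
    case 0
    from ne(1) obtain c where "c \<in> X" by blast
    moreover have "{x \<in> X. x - c \<in> V 0} = X" using XT \<open>c \<in> X\<close> by (auto simp: V_def)
    ultimately show ?case by (intro bexI[of _ c]) simp_all
  next
    case (Suc j)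
    then obtain c where c: "c \<in> X"
      "card X * (card X * card Y) ^ j \<le> (p * q) ^ j * card {x \<in> X. x - c \<in> V j}" by blast
    \<comment> \<open>One step goes from \<open>X\<close> to \<open>\<alpha> Y\<close> at a cost of
      \<open>p / card Y\<close>, and from \<open>Y\<close> back to \<open>X\<close> at a cost of
      \<open>q / card X\<close>. On \<open>Y\<close> the index rises from \<open>j\<close> to
      \<open>j + 1\<close> for free, because differences of \<open>Y\<close> lie in the span of
      \<open>T\<close>.\<close>
    obtain z where z: "z \<in> (*) \<alpha> ` Y" "card ((*) \<alpha> ` Y) * card {x \<in> X. x - c \<in> V j}
        \<le> p * card {y \<in> (*) \<alpha> ` Y. y - z \<in> V j}"
      unfolding p_def
      using coset_counting[of X "(*) \<alpha> ` Y" "V j" c] fin ne Vdiff by blast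
    then obtain y0 where y0: "y0 \<in> Y" "z = \<alpha> * y0" by blast
    have "{y \<in> (*) \<alpha> ` Y. y - z \<in> V j} \<subseteq> (*) \<alpha> ` {y \<in> Y. y - y0 \<in> V (Suc j)}"
      using YT y0 by (auto simp: right_diff_distrib[symmetric] intro!: VSuc)
    hence "card {y \<in> (*) \<alpha> ` Y. y - z \<in> V j} \<le> card ((*) \<alpha> ` {y \<in> Y. y - y0 \<in> V (Suc j)})"
      using fin by (intro card_mono) auto
    also have "\<dots> = card {y \<in> Y. y - y0 \<in> V (Suc j)}" by (rule card_image) (rule inj)
    finally have 1: "card Y * card {x \<in> X. x - c \<in> V j} \<le> p * card {y \<in> Y. y - y0 \<in> V (Suc j)}"
      using z(2) by (simp add: card_image[OF inj] order_trans)
    obtain c' where c': "c' \<in> X" "card X * card {y \<in> Y. y - y0 \<in> V (Suc j)}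
        \<le> q * card {x \<in> X. x - c' \<in> V (Suc j)}"
      using coset_counting[of Y X "V (Suc j)" y0] fin ne Vdiff
      unfolding q_def card_diff_set_swap[of Y X] by blast
    have "card X * (card X * card Y) ^ Suc j = card X * card Y * (card X * (card X * card Y) ^ j)"
      by simp
    also have "\<dots> \<le> card X * card Y * ((p * q) ^ j * card {x \<in> X. x - c \<in> V j})"
      by (intro mult_left_mono c(2)) simp
    also have "\<dots> = card X * (p * q) ^ j * (card Y * card {x \<in> X. x - c \<in> V j})" by simp
    also have "\<dots> \<le> card X * (p * q) ^ j * (p * card {y \<in> Y. y - y0 \<in> V (Suc j)})"
      by (intro mult_left_mono 1) simp
    also have "\<dots> = (p * q) ^ j * p * (card X * card {y \<in> Y. y - y0 \<in> V (Suc j)})" by simp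
    also have "\<dots> \<le> (p * q) ^ j * p * (q * card {x \<in> X. x - c' \<in> V (Suc j)})"
      by (intro mult_left_mono c'(2)) simp
    also have "\<dots> = (p * q) ^ Suc j * card {x \<in> X. x - c' \<in> V (Suc j)}" by simp
    finally show ?case using c'(1) by blast
  qed
  then obtain c where c: "c \<in> X"
    "card X * (card X * card Y) ^ d \<le> (p * q) ^ d * card {x \<in> X. x - c \<in> V d}" by blast
  have "v = 0" if "v \<in> V d" for v
    using algebraic_if_powers_in_span[OF T, of v \<alpha>] that nonalg by (auto simp: V_def)
  hence "{x \<in> X. x - c \<in> V d} \<subseteq> {c}" by fastforce
  from card_mono[OF _ this] have "card {x \<in> X. x - c \<in> V d} \<le> 1" by simp
  hence "(p * q) ^ d * card {x \<in> X. x - c \<in> V d} \<le> (p * q) ^ d * 1" by (intro mult_left_mono) auto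
  with c(2) have "card X * (card X * card Y) ^ d \<le> (p * q) ^ d" by (auto intro: order_trans)
  thus ?thesis by (simp add: p_def q_def)
qed

section \<open>Counting with four projections\<close>

text \<open>Pigeonhole: at most \<open>D\<close> fibres cover \<open>A\<close>, so the fullest one
  has at least the average size.\<close>

lemma large_fibre:
  fixes f :: "'a \<Rightarrow> real"
  assumes "finite A" "A \<noteq> {}" "card (f ` A) \<le> D"
  obtains a where "a \<in> A" "card A \<le> card {b \<in> A. f b = f a} * D"
proof -
  define m where "m = (\<lambda>y. card {b \<in> A. f b = y})"
  have "Max (m ` f ` A) \<in> m ` f ` A" using assms(1,2) by simp
  then obtain a where a: "a \<in> A" "m (f a) = Max (m ` f ` A)" by force
  have "card A = (\<Sum>y\<in>f ` A. m y)"
    using sum.group[OF assms(1) finite_imageI[OF assms(1)] subset_refl, of "\<lambda>_. 1 :: nat" f] by (simp add: m_def)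
  also have "\<dots> \<le> card (f ` A) * m (f a)"
    using sum_bounded_above[of "f ` A" m "m (f a)"] assms(1) a(2) by auto
  also have "\<dots> \<le> m (f a) * D" using assms(3) by simp
  finally show ?thesis using that a(1) by (simp add: m_def)
qed

text \<open>The combinatorial core, with no norm in it. Freiman's lemma puts the values of
  \<open>f1\<close> and \<open>f2\<close> on \<open>A0\<close> in few rational dimensions, slices of
  \<open>A0\<close> give sets \<open>X\<close>, \<open>Y\<close> of size at least
  \<open>n ^ 2 / D\<close>, and the descent along dilates by \<alpha> plays these against difference
  sets of size at most \<open>D ^ 2 / n\<close>.\<close>

lemma four_projections_bound:
  fixes f1 f2 :: "'a \<Rightarrow> real" and A A0 :: "'a set" and B1 B2 B3 B4 :: "real set" and n D :: nat
  assumes nonalg: "\<not> algebraic \<alpha>" and "finite A" "A0 \<subseteq> A" "n > 0" "n ^ 2 \<le> card A0"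
    and inj: "inj_on (\<lambda>a. (f1 a, f2 a)) A"
    and below1: "n \<le> card {b \<in> f1 ` A. \<forall>x\<in>f1 ` A0. b < x}"
    and below2: "n \<le> card {b \<in> f2 ` A. \<forall>x\<in>f2 ` A0. b < x}"
    and finB: "finite B1" "finite B2" "finite B3" "finite B4"
    and cardB: "n \<le> card B1" "n \<le> card B2" "n \<le> card B3" "n \<le> card B4"
    and D1: "card (diff_set B1 (f1 ` A)) \<le> D"
    and D2: "card (diff_set B2 (f2 ` A)) \<le> D"
    and D3: "card (diff_set B3 ((\<lambda>a. f1 a + f2 a) ` A)) \<le> D"
    and D4: "card (diff_set B4 ((\<lambda>a. f1 a + \<alpha> * f2 a) ` A)) \<le> D"
  shows "real n \<le> (real D / real n) ^ (12 * (D div n) + 1)" and "n \<le> D"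
proof -
  \<comment> \<open>The largest \<open>d\<close> with \<open>n * d \<le> D\<close>: needing more
    than \<open>d\<close> rational dimensions would force \<open>n * (d + 1) > D\<close>
    differences.\<close>
  define d where "d = D div n"
  have "D < n * (d + 1)"
    using \<open>n > 0\<close> dividend_less_times_div[of n D] by (simp add: d_def)
  have ne0: "A0 \<noteq> {}" using \<open>n > 0\<close> \<open>n ^ 2 \<le> card A0\<close> by auto
  have fin0: "finite A0" using assms(2,3) by (rule rev_finite_subset)
  obtain a0 where a0: "a0 \<in> A0" using ne0 by blast
  have "A \<noteq> {}" using ne0 assms(3) by blast
  have "B1 \<noteq> {}" "B2 \<noteq> {}" using cardB \<open>n > 0\<close> by auto
  have le1: "card (f1 ` A) \<le> D"
    using card_le_card_diff_set(2)[of B1 "f1 ` A"] finB(1) assms(2) \<open>B1 \<noteq> {}\<close> D1 by simp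
  have le2: "card (f2 ` A) \<le> D"
    using card_le_card_diff_set(2)[of B2 "f2 ` A"] finB(2) assms(2) \<open>B2 \<noteq> {}\<close> D2 by simp
  show "n \<le> D"
    using card_le_card_diff_set(1)[of B1 "f1 ` A"] finB(1) assms(2) \<open>A \<noteq> {}\<close> D1 cardB(1) by simp
  have "\<exists>T. finite T \<and> card T \<le> d \<and> (\<forall>x\<in>f1 ` A0. x - f1 a0 \<in> rat_vs.span T)"
  proof (rule ccontr)
    assume "\<not> ?thesis"
    from freiman_dimension[OF finB(1) _ cardB(1) below1 _ _ this] D1 a0 assms(2,3) \<open>D < n * (d + 1)\<close>
    show False by auto
  qed
  then obtain T1 where T1: "finite T1" "card T1 \<le> d" "\<And>x. x \<in> A0 \<Longrightarrow> f1 x - f1 a0 \<in> rat_vs.span T1"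
    by auto
  have "\<exists>T. finite T \<and> card T \<le> d \<and> (\<forall>x\<in>f2 ` A0. x - f2 a0 \<in> rat_vs.span T)"
  proof (rule ccontr)
    assume "\<not> ?thesis"
    from freiman_dimension[OF finB(2) _ cardB(2) below2 _ _ this] D2 a0 assms(2,3) \<open>D < n * (d + 1)\<close>
    show False by auto
  qed
  then obtain T2 where T2: "finite T2" "card T2 \<le> d" "\<And>x. x \<in> A0 \<Longrightarrow> f2 x - f2 a0 \<in> rat_vs.span T2"
    by auto
  define T where "T = T1 \<union> T2"
  have T: "finite T" "card T \<le> 2 * d"
    using T1(1,2) T2(1,2) card_Un_le[of T1 T2] by (auto simp: T_def)
  have span: "rat_vs.span T1 \<subseteq> rat_vs.span T" "rat_vs.span T2 \<subseteq> rat_vs.span T"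
    by (auto simp: T_def intro!: rat_vs.span_mono)
  have span1: "f1 x - f1 y \<in> rat_vs.span T" if "x \<in> A0" "y \<in> A0" for x y
    using rat_vs.span_diff[OF T1(3)[OF that(1)] T1(3)[OF that(2)]] span(1) by auto
  have span2: "f2 x - f2 y \<in> rat_vs.span T" if "x \<in> A0" "y \<in> A0" for x y
    using rat_vs.span_diff[OF T2(3)[OF that(1)] T2(3)[OF that(2)]] span(2) by auto
  have "card (f1 ` A0) \<le> D" "card (f2 ` A0) \<le> D"
    using le1 le2 assms(2,3) by (meson card_mono finite_imageI image_mono order_trans)+
  obtain p where p: "p \<in> A0" "card A0 \<le> card {b \<in> A0. f2 b = f2 p} * D"
    using large_fibre[OF fin0 ne0 \<open>card (f2 ` A0) \<le> D\<close>] .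
  obtain q where q: "q \<in> A0" "card A0 \<le> card {b \<in> A0. f1 b = f1 q} * D"
    using large_fibre[OF fin0 ne0 \<open>card (f1 ` A0) \<le> D\<close>] .
  \<comment> \<open>\<open>X\<close> comes from a horizontal slice and \<open>Y\<close> from a
    vertical one. On a slice the other coordinate is injective, as the two together separate the
    points of \<open>A\<close>.\<close>
  define X Y where "X = f1 ` {b \<in> A0. f2 b = f2 p}" and "Y = f2 ` {b \<in> A0. f1 b = f1 q}"
  have "card X = card {b \<in> A0. f2 b = f2 p}"
    unfolding X_def
  proof (intro card_image inj_onI)
    fix x y assume "x \<in> {b \<in> A0. f2 b = f2 p}" "y \<in> {b \<in> A0. f2 b = f2 p}" "f1 x = f1 y"
    thus "x = y" using inj_onD[OF inj, of x y] assms(3) by auto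
  qed
  hence cX: "n ^ 2 \<le> card X * D" using p(2) \<open>n ^ 2 \<le> card A0\<close> by simp
  have "card Y = card {b \<in> A0. f1 b = f1 q}"
    unfolding Y_def
  proof (intro card_image inj_onI)
    fix x y assume "x \<in> {b \<in> A0. f1 b = f1 q}" "y \<in> {b \<in> A0. f1 b = f1 q}" "f2 x = f2 y"
    thus "x = y" using inj_onD[OF inj, of x y] assms(3) by auto
  qed
  hence cY: "n ^ 2 \<le> card Y * D" using q(2) \<open>n ^ 2 \<le> card A0\<close> by simp
  have finXY: "finite X" "finite Y" using fin0 by (auto simp: X_def Y_def)
  have neXY: "X \<noteq> {}" "Y \<noteq> {}" using p q by (auto simp: X_def Y_def)
  \<comment> \<open>Up to one fixed shift, \<open>f1 a - \<beta> * f2 b\<close> for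
    \<open>a\<close>, \<open>b\<close> on the two slices is a difference of two values of
    \<open>f1 + \<beta> * f2\<close>; the triangle inequality through \<open>B\<close> bounds the
    number of these. It serves for \<open>\<beta> = \<alpha>\<close> and
    \<open>\<beta> = 1\<close>.\<close>
  have small: "card (diff_set X ((*) \<beta> ` Y)) * n \<le> D ^ 2"
    if D': "card (diff_set B ((\<lambda>a. f1 a + \<beta> * f2 a) ` A)) \<le> D" and B: "finite B" "n \<le> card B" for \<beta> B
  proof -
    define Z where "Z = (\<lambda>a. f1 a + \<beta> * f2 a) ` A"
    have finZ: "finite Z" using assms(2) by (simp add: Z_def)
    have "(\<lambda>v. v + (\<beta> * f2 p - f1 q)) ` diff_set X ((*) \<beta> ` Y) \<subseteq> diff_set Z Z"
    proof clarify
      fix v assume "v \<in> diff_set X ((*) \<beta> ` Y)"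
      then obtain a b where ab: "a \<in> A0" "f2 a = f2 p" "b \<in> A0" "f1 b = f1 q" "v = f1 a - \<beta> * f2 b"
        by (auto elim!: diff_setE simp: X_def Y_def)
      have "v + (\<beta> * f2 p - f1 q) = (f1 a + \<beta> * f2 a) - (f1 b + \<beta> * f2 b)" using ab by simp
      also have "\<dots> \<in> diff_set Z Z"
      proof (rule diff_setI)
        show "f1 a + \<beta> * f2 a \<in> Z" "f1 b + \<beta> * f2 b \<in> Z"
          using ab(1,3) assms(3) unfolding Z_def by blast+
      qed
      finally show "v + (\<beta> * f2 p - f1 q) \<in> diff_set Z Z" .
    qed
    hence "card (diff_set X ((*) \<beta> ` Y)) \<le> card (diff_set Z Z)"
      using finZ by (intro card_inj_on_le[where f = "\<lambda>v. v + (\<beta> * f2 p - f1 q)"]) auto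
    hence "card (diff_set X ((*) \<beta> ` Y)) * n \<le> card (diff_set Z Z) * card B"
      using B(2) by (rule mult_le_mono)
    also have "\<dots> \<le> card (diff_set Z B) * card (diff_set B Z)"
      using finZ B(1) by (intro ruzsa_triangle)
    also have "\<dots> \<le> D * D"
      using D' card_diff_set_swap[of B Z] unfolding Z_def[symmetric] by (intro mult_le_mono) linarith+
    finally show ?thesis by (simp add: power2_eq_square)
  qed
  define P Q where "P = card (diff_set X ((*) \<alpha> ` Y))" and "Q = card (diff_set X Y)"
  have "P * n \<le> D ^ 2" unfolding P_def using small[OF D4 finB(4) cardB(4)] .
  moreover have "Q * n \<le> D ^ 2" unfolding Q_def using small[of B3 1] D3 finB(3) cardB(3) by simp
  ultimately have PQ: "(P * n) * (Q * n) \<le> D ^ 2 * D ^ 2" by (rule mult_le_mono)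
  have core: "card X * (card X * card Y) ^ (2 * d) \<le> (P * Q) ^ (2 * d)"
    unfolding P_def Q_def
    by (rule transcendental_dilate_bound[OF nonalg finXY neXY T]) (auto simp: X_def Y_def intro: span1 span2)
  have "D > 0" using \<open>n \<le> D\<close> \<open>n > 0\<close> by simp
  \<comment> \<open>A lower bound for both \<open>card X\<close> and \<open>card Y\<close>. Writing
    the bound for \<open>P * Q\<close> as \<open>(D / n) ^ 6 * u ^ 2\<close> lets
    \<open>u ^ (4 * d)\<close> cancel; one more factor \<open>D / n\<close> turns \<open>u\<close>
    into \<open>n\<close>.\<close>
  define u where "u = real n ^ 2 / real D"
  have u0: "u > 0" using \<open>n > 0\<close> \<open>D > 0\<close> by (simp add: u_def)
  have uX: "u \<le> card X" and uY: "u \<le> card Y"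
    using cX[THEN of_nat_mono[where 'a = real]] cY[THEN of_nat_mono[where 'a = real]] \<open>D > 0\<close>
    by (simp_all add: u_def divide_simps)
  have w: "real (P * Q) \<le> real D ^ 4 / real n ^ 2"
    using PQ[THEN of_nat_mono[where 'a = real]] \<open>n > 0\<close>
    by (simp add: divide_simps power2_eq_square eval_nat_numeral mult_ac)
  have "u * (u * u) ^ (2 * d) \<le> real (card X) * (real (card X) * real (card Y)) ^ (2 * d)"
    using uX uY u0 by (intro mult_mono power_mono) auto
  also have "\<dots> \<le> real (P * Q) ^ (2 * d)"
    using core[THEN of_nat_mono[where 'a = real]] by simp
  also have "\<dots> \<le> (real D ^ 4 / real n ^ 2) ^ (2 * d)" by (intro power_mono w) simp
  also have "real D ^ 4 / real n ^ 2 = (real D / real n) ^ 6 * (u * u)"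
    using \<open>D > 0\<close> \<open>n > 0\<close> by (simp add: u_def field_simps eval_nat_numeral)
  also have "(\<dots>) ^ (2 * d) = (real D / real n) ^ (12 * d) * (u * u) ^ (2 * d)"
    by (simp add: power_mult_distrib power_mult[symmetric] mult_ac)
  finally have "u \<le> (real D / real n) ^ (12 * d)" using u0 by simp
  hence "real D / real n * u \<le> real D / real n * (real D / real n) ^ (12 * d)"
    by (intro mult_left_mono) simp_all
  moreover have "real D / real n * u = real n"
    using \<open>D > 0\<close> \<open>n > 0\<close> by (simp add: u_def power2_eq_square)
  ultimately show "real n \<le> (real D / real n) ^ (12 * (D div n) + 1)" by (simp add: d_def)
qed

lemma log_bound_from_power_bound:
  fixes n D :: nat
  assumes "real n \<le> (real D / real n) ^ (12 * (D div n) + 1)" "n \<le> D" "n > 0"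
  shows "ln (real n) \<le> 13 * (real D / real n) * ln (real D / real n)"
proof -
  define l where "l = real D / real n"
  have l: "l \<ge> 1" using assms(2,3) by (simp add: l_def)
  have "real (D div n) \<le> l" unfolding l_def by (rule of_nat_div_le_of_nat)
  have "ln (real n) \<le> ln (l ^ (12 * (D div n) + 1))" using assms(1,3) l by (simp add: l_def)
  also have "\<dots> = real (12 * (D div n) + 1) * ln l" by (rule ln_realpow)
  also have "\<dots> \<le> (13 * l) * ln l"
  proof (rule mult_right_mono)
    show "real (12 * (D div n) + 1) \<le> 13 * l" using l \<open>real (D div n) \<le> l\<close> by simp
  qed (use l in simp)
  finally show ?thesis by (simp add: l_def)
qed

subsection \<open>Polygonal norms\<close>

text \<open>\<open>p\<close> is, up to a factor, the linear form of a side: \<open>nrm\<close> is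
  linear near some unit vector \<open>v\<close>. The free factor \<open>c\<close> makes the notion
  invariant under rescaling, so that forms can be normalised later.\<close>

definition norming :: "(real ^ 2 \<Rightarrow> real) \<Rightarrow> real ^ 2 \<Rightarrow> bool" where
  "norming nrm p \<longleftrightarrow>
     (\<exists>c v e. c \<noteq> 0 \<and> nrm v = 1 \<and> e > 0 \<and> (\<forall>w. nrm (w - v) \<le> e \<longrightarrow> nrm w = c * (p \<bullet> w)))"

lemma norming_scaleR:
  assumes "norming nrm p" "r \<noteq> 0"
  shows "norming nrm (r *\<^sub>R p)"
proof -
  obtain c v e where cve: "c \<noteq> 0" "nrm v = 1" "e > 0" "\<And>w. nrm (w - v) \<le> e \<Longrightarrow> nrm w = c * (p \<bullet> w)"
    using assms(1) unfolding norming_def by blast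
  thus ?thesis using \<open>r \<noteq> 0\<close> unfolding norming_def
    by (intro exI[of _ "c / r"] exI[of _ v] exI[of _ e]) simp
qed

text \<open>Cramer's rule: \<open>u\<close> and \<open>v\<close> are the columns of the inverse of
  the matrix with rows \<open>a\<close> and \<open>b\<close>.\<close>

lemma dual_basis_exists:
  fixes a b :: "real ^ 2"
  assumes "a $ 1 * b $ 2 \<noteq> a $ 2 * b $ 1"
  obtains u v where "a \<bullet> u = 1" "a \<bullet> v = 0" "b \<bullet> u = 0" "b \<bullet> v = 1"
    "\<And>x. x = (a \<bullet> x) *\<^sub>R u + (b \<bullet> x) *\<^sub>R v"
proof -
  define D where "D = a $ 1 * b $ 2 - a $ 2 * b $ 1"
  have "D \<noteq> 0" using assms by (simp add: D_def)
  define u v :: "real ^ 2" where "u = (1 / D) *\<^sub>R vector [b $ 2, - b $ 1]"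
    and "v = (1 / D) *\<^sub>R vector [- a $ 2, a $ 1]"
  show ?thesis
  proof
    show "a \<bullet> u = 1" "a \<bullet> v = 0" "b \<bullet> u = 0" "b \<bullet> v = 1"
      using \<open>D \<noteq> 0\<close> by (simp_all add: u_def v_def inner_vec_def sum_2 field_simps) (simp_all add: D_def)
    show "x = (a \<bullet> x) *\<^sub>R u + (b \<bullet> x) *\<^sub>R v" for x
    proof -
      have "D * x $ 1 = (a \<bullet> x) * b $ 2 - (b \<bullet> x) * a $ 2" "D * x $ 2 = (b \<bullet> x) * a $ 1 - (a \<bullet> x) * b $ 1"
        by (simp_all add: D_def inner_vec_def sum_2 algebra_simps)
      thus ?thesis using \<open>D \<noteq> 0\<close>
        by (simp add: vec_eq_iff forall_2 u_def v_def field_simps)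
    qed
  qed
qed

lemma coordinate_system_if_dual:
  assumes "a \<bullet> u = 1" "b \<bullet> u = 0" "b \<bullet> v = 1"
  shows "coordinate_system u v"
  unfolding coordinate_system_def collinear_lemma
  using assms by auto

locale polygonal_norm =
  fixes nrm :: "real ^ 2 \<Rightarrow> real"
  assumes is_norm: "is_norm nrm" and polytope: "polytope (unit_ball nrm)"
begin

lemma nrm_eq_0_iff [simp]: "nrm x = 0 \<longleftrightarrow> x = 0"
  and nrm_scaleR: "nrm (a *\<^sub>R x) = \<bar>a\<bar> * nrm x"
  and nrm_triangle: "nrm (x + y) \<le> nrm x + nrm y"
  using is_norm unfolding is_norm_def by blast+

lemma nrm_zero [simp]: "nrm 0 = 0"
  using nrm_eq_0_iff by blast

lemma nrm_minus: "nrm (- x) = nrm x"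
  using nrm_scaleR[of "-1" x] by simp

lemma nrm_minus_commute: "nrm (x - y) = nrm (y - x)"
  using nrm_minus[of "x - y"] by simp

lemma nrm_nonneg [simp]: "0 \<le> nrm x"
  using nrm_triangle[of x "- x"] by (simp add: nrm_minus)

lemma nrm_pos: "x \<noteq> 0 \<Longrightarrow> nrm x > 0"
  using nrm_nonneg[of x] nrm_eq_0_iff[of x] by linarith

lemma nrm_triangle_diff: "\<bar>nrm x - nrm y\<bar> \<le> nrm (x - y)"
  using nrm_triangle[of "x - y" y] nrm_triangle[of "y - x" x] nrm_minus_commute[of x y] by simp

lemma nrm_normalize: "x \<noteq> 0 \<Longrightarrow> nrm ((1 / nrm x) *\<^sub>R x) = 1"
  by (simp add: nrm_scaleR)

lemma norm_le_nrm: obtains M where "M > 0" "\<And>x. norm x \<le> M * nrm x"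
proof -
  obtain M where M: "M > 0" "\<And>x. x \<in> unit_ball nrm \<Longrightarrow> norm x \<le> M"
    using polytope_imp_bounded[OF polytope] unfolding bounded_pos by blast
  have "norm x \<le> M * nrm x" for x
  proof (cases "x = 0")
    case False
    have "norm ((1 / nrm x) *\<^sub>R x) \<le> M"
      using False by (intro M(2)) (simp add: unit_ball_def nrm_normalize)
    thus ?thesis using nrm_pos[OF False] by (simp add: divide_simps)
  qed simp
  with M(1) show ?thesis by (rule that)
qed

lemma inner_le_nrm: obtains C where "C > 0" "\<And>x. \<bar>p \<bullet> x\<bar> \<le> C * nrm x"
proof -
  obtain M where M: "M > 0" "\<And>x. norm x \<le> M * nrm x" by (rule norm_le_nrm) blast
  show ?thesis
  proof
    show "norm p * M + 1 > 0" using M(1) by (smt (verit) mult_nonneg_nonneg norm_ge_zero)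
    show "\<bar>p \<bullet> x\<bar> \<le> (norm p * M + 1) * nrm x" for x
    proof -
      have "\<bar>p \<bullet> x\<bar> \<le> norm p * norm x" by (rule Cauchy_Schwarz_ineq2)
      also have "\<dots> \<le> norm p * (M * nrm x)" by (intro mult_left_mono M) simp
      also have "\<dots> \<le> (norm p * M + 1) * nrm x" by (simp add: algebra_simps)
      finally show ?thesis .
    qed
  qed
qed

text \<open>Expanding in the standard basis bounds \<open>nrm\<close> by a multiple of the Euclidean
  norm.\<close>

lemma zero_in_interior_unit_ball: "0 \<in> interior (unit_ball nrm)"
proof -
  define C where "C = nrm (axis 1 1) + nrm (axis 2 1) + 1"
  have "C > 0" unfolding C_def by (intro add_nonneg_pos add_nonneg_nonneg) simp_all
  have "nrm x \<le> C * norm x" for x :: "real ^ 2"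
  proof -
    have "x = x $ 1 *\<^sub>R axis 1 1 + x $ 2 *\<^sub>R axis 2 1"
      by (simp add: vec_eq_iff forall_2 axis_def)
    hence "nrm x \<le> nrm (x $ 1 *\<^sub>R axis 1 1) + nrm (x $ 2 *\<^sub>R axis 2 1)"
      by (metis nrm_triangle)
    also have "\<dots> \<le> norm x * nrm (axis 1 1) + norm x * nrm (axis 2 1)"
      unfolding nrm_scaleR by (intro add_mono mult_right_mono component_le_norm_cart) simp_all
    also have "\<dots> \<le> C * norm x" by (simp add: C_def algebra_simps)
    finally show ?thesis .
  qed
  hence "ball 0 (1 / C) \<subseteq> unit_ball nrm"
    using \<open>C > 0\<close> by (fastforce simp: unit_ball_def divide_simps mult_ac intro: order_trans)
  moreover have "1 / C > 0" using \<open>C > 0\<close> by simp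
  ultimately show ?thesis unfolding mem_interior by blast
qed

lemma aff_dim_unit_ball: "aff_dim (unit_ball nrm) = 2"
  using zero_in_interior_unit_ball interior_rel_interior_gen[of "unit_ball nrm"]
  by (auto split: if_splits)

text \<open>A unit vector is a boundary point, since stretching it slightly leaves the ball, and the
  relative boundary of a polyhedron is the union of its facets.\<close>

lemma exists_facet_through:
  assumes "nrm w = 1"
  obtains F where "F facet_of unit_ball nrm" "w \<in> F"
proof -
  have "w \<notin> interior (unit_ball nrm)"
  proof
    assume "w \<in> interior (unit_ball nrm)"
    then obtain e where e: "e > 0" "ball w e \<subseteq> unit_ball nrm" by (auto simp: mem_interior)
    have "w \<noteq> 0" using assms by auto
    define t where "t = e / (2 * norm w)"
    have "t > 0" using e(1) \<open>w \<noteq> 0\<close> by (simp add: t_def)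
    have "norm w * t < e" using e(1) \<open>w \<noteq> 0\<close> by (simp add: t_def)
    hence "(1 + t) *\<^sub>R w \<in> ball w e"
      using \<open>t > 0\<close> by (simp add: dist_norm algebra_simps)
    hence "nrm ((1 + t) *\<^sub>R w) \<le> 1" using e(2) by (auto simp: unit_ball_def)
    thus False using \<open>t > 0\<close> assms by (simp add: nrm_scaleR)
  qed
  hence "w \<notin> rel_interior (unit_ball nrm)"
    using zero_in_interior_unit_ball rel_interior_nonempty_interior by (metis emptyE)
  moreover have "w \<in> unit_ball nrm" using assms by (simp add: unit_ball_def)
  ultimately show ?thesis
    using rel_boundary_of_polyhedron[OF polytope_imp_polyhedron[OF polytope]] that by auto
qed

section \<open>Facets and their normals\<close>

text \<open>The outer normal of a facet, normalised to level \<open>1\<close>; equivalently, the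
  vertex of the polar polygon that belongs to the facet.\<close>

definition facet_normal :: "real ^ 2 \<Rightarrow> bool" where
  "facet_normal a \<longleftrightarrow>
     (unit_ball nrm \<inter> {x. a \<bullet> x = 1}) facet_of unit_ball nrm \<and> (\<forall>x\<in>unit_ball nrm. a \<bullet> x \<le> 1)"

text \<open>Faces of a polyhedron are exposed, which gives a supporting line at some level
  \<open>b\<close>. As the ball contains a positive multiple of the normal, \<open>b > 0\<close>,
  and the level can be scaled to \<open>1\<close>.\<close>

lemma facet_has_normal:
  assumes "F facet_of unit_ball nrm"
  obtains a where "facet_normal a" "F = unit_ball nrm \<inter> {x. a \<bullet> x = 1}"
proof -
  let ?B = "unit_ball nrm"
  have "F exposed_face_of ?B"
    using assms polytope_imp_polyhedron[OF polytope]
    by (simp add: exposed_face_of_polyhedron facet_of_imp_face_of)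
  then obtain a b where ab: "?B \<subseteq> {x. a \<bullet> x \<le> b}" "F = ?B \<inter> {x. a \<bullet> x = b}"
    unfolding exposed_face_of_def by blast
  have F: "F \<noteq> {}" "F \<noteq> ?B" using assms by (auto simp: facet_of_def)
  have "a \<noteq> 0"
  proof
    assume "a = 0"
    hence "F = (if b = 0 then ?B else {})" using ab(2) by auto
    with F show False by (auto split: if_splits)
  qed
  have "b > 0"
  proof -
    define y where "y = (1 / nrm a) *\<^sub>R a"
    have "y \<in> ?B" using nrm_normalize[OF \<open>a \<noteq> 0\<close>] by (simp add: y_def unit_ball_def)
    hence "a \<bullet> y \<le> b" using ab(1) by auto
    moreover have "a \<bullet> y > 0" using \<open>a \<noteq> 0\<close> nrm_pos[OF \<open>a \<noteq> 0\<close>] by (simp add: y_def)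
    ultimately show ?thesis by linarith
  qed
  define a' where "a' = (1 / b) *\<^sub>R a"
  have "F = ?B \<inter> {x. a' \<bullet> x = 1}" "\<forall>x\<in>?B. a' \<bullet> x \<le> 1"
    using ab \<open>b > 0\<close> by (auto simp: a'_def field_simps)
  with assms that[of a'] show ?thesis by (simp add: facet_normal_def)
qed

text \<open>A relative interior point \<open>v\<close> of a facet lies on no other facet. The others
  form a closed set, so unit vectors near \<open>v\<close> lie on this facet, where
  \<open>a \<bullet> x = 1\<close>, and homogeneity extends this to all vectors near
  \<open>v\<close>.\<close>

lemma facet_normal_norming:
  assumes "facet_normal a"
  shows "norming nrm a"
proof -
  let ?B = "unit_ball nrm"
  define F where "F = ?B \<inter> {x. a \<bullet> x = 1}"
  have F: "F facet_of ?B" using assms by (simp add: facet_normal_def F_def)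
  have conv: "convex ?B" and clos: "closed ?B"
    using polytope by (auto intro: polytope_imp_convex polytope_imp_closed)
  have "convex F" "F \<noteq> {}" using F by (auto simp: facet_of_def face_of_imp_convex)
  then obtain v where v: "v \<in> rel_interior F" using rel_interior_eq_empty by blast
  hence "v \<in> F" using rel_interior_subset by blast
  hence av: "a \<bullet> v = 1" "nrm v \<le> 1" by (auto simp: F_def unit_ball_def)
  have "v \<noteq> 0" using av by auto
  have "nrm v = 1"
  proof -
    have "(1 / nrm v) *\<^sub>R v \<in> ?B"
      using nrm_normalize[OF \<open>v \<noteq> 0\<close>] by (simp add: unit_ball_def)
    hence "a \<bullet> ((1 / nrm v) *\<^sub>R v) \<le> 1"
      using assms unfolding facet_normal_def by blast
    thus ?thesis using av nrm_pos[OF \<open>v \<noteq> 0\<close>] by (simp add: divide_simps)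
  qed
  have only: "G = F" if G: "G facet_of ?B" "v \<in> G" for G
  proof -
    have "F \<subseteq> G"
      using subset_of_face_of[of G ?B F] G v F
      by (auto simp: facet_of_imp_face_of facet_of_imp_subset)
    hence "F face_of G"
      using F G by (meson face_of_subset facet_of_imp_face_of facet_of_imp_subset)
    moreover have "convex G" using G by (auto simp: facet_of_def face_of_imp_convex)
    moreover have "aff_dim F = aff_dim G" using F G by (simp add: facet_of_def)
    ultimately show "G = F" using face_of_aff_dim_lt[of G F] by auto
  qed
  define U where "U = \<Union>({G. G facet_of ?B} - {F})"
  have "closed U" unfolding U_def
    using finite_polytope_facets[OF polytope] conv clos
    by (intro closed_Union) (auto intro: face_of_imp_closed facet_of_imp_face_of)
  moreover have "v \<notin> U" using only by (auto simp: U_def)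
  ultimately obtain d where d: "d > 0" "ball v d \<subseteq> - U"
    using openE[of "- U" v] by auto
  obtain M where M: "M > 0" "\<And>x. norm x \<le> M * nrm x" by (rule norm_le_nrm) blast
  \<comment> \<open>The bound \<open>1 / 2\<close> keeps \<open>w\<close> away from
    \<open>0\<close>. Normalising \<open>w\<close> at most doubles the bound \<open>e\<close> on its
    distance to \<open>v\<close>, so \<open>d / (4 * M)\<close> keeps the result within Euclidean
    distance \<open>d / 2\<close>.\<close>
  define e where "e = min (1 / 2) (d / (4 * M))"
  have "e > 0" using d(1) M(1) by (simp add: e_def)
  have "nrm w = 1 * (a \<bullet> w)" if w: "nrm (w - v) \<le> e" for w
  proof -
    have close: "\<bar>nrm w - 1\<bar> \<le> e" using nrm_triangle_diff[of w v] w \<open>nrm v = 1\<close> by simp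
    have "e \<le> 1 / 2" by (simp add: e_def)
    hence "nrm w > 0" using close by linarith
    have "w \<noteq> 0"
    proof
      assume "w = 0"
      with \<open>nrm w > 0\<close> show False by simp
    qed
    define y where "y = (1 / nrm w) *\<^sub>R w"
    have "nrm y = 1" unfolding y_def by (rule nrm_normalize) fact
    have "y - w = (1 / nrm w - 1) *\<^sub>R w" by (simp add: y_def algebra_simps)
    hence "nrm (y - w) = \<bar>1 / nrm w - 1\<bar> * nrm w" by (simp add: nrm_scaleR)
    also have "\<dots> = \<bar>(1 / nrm w - 1) * nrm w\<bar>" by (simp add: abs_mult)
    also have "(1 / nrm w - 1) * nrm w = 1 - nrm w"
      using \<open>w \<noteq> 0\<close> by (simp add: left_diff_distrib)
    finally have "nrm (y - w) \<le> e" using close by simp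
    hence "nrm (y - v) \<le> 2 * e" using nrm_triangle[of "y - w" "w - v"] w by simp
    have "norm (y - v) \<le> M * nrm (y - v)" by (rule M)
    also have "\<dots> \<le> M * (2 * e)" using \<open>nrm (y - v) \<le> 2 * e\<close> M(1) by (intro mult_left_mono) auto
    also have "\<dots> \<le> M * (2 * (d / (4 * M)))" using M(1) by (intro mult_left_mono) (auto simp: e_def)
    also have "\<dots> < d" using M(1) d(1) by simp
    finally have "y \<notin> U" using d(2) by (auto simp: dist_norm norm_minus_commute)
    moreover obtain G where "G facet_of ?B" "y \<in> G" using exists_facet_through[OF \<open>nrm y = 1\<close>] .
    ultimately have "y \<in> F" by (auto simp: U_def)
    hence "a \<bullet> y = 1" by (simp add: F_def)
    moreover have "a \<bullet> w = nrm w * (a \<bullet> y)" using \<open>w \<noteq> 0\<close> by (simp add: y_def)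
    ultimately show ?thesis by simp
  qed
  thus ?thesis unfolding norming_def using \<open>nrm v = 1\<close> \<open>e > 0\<close>
    by (intro exI[of _ 1] exI[of _ v] exI[of _ e]) auto
qed

text \<open>The facet lies on the line with coefficients \<open>a \<bullet> e1\<close>,
  \<open>a \<bullet> e2\<close> and \<open>- 1\<close>; affine dimension 1 supplies the two distinct
  points that make the slope unique.\<close>

lemma slope_of_facet:
  assumes cs: "coordinate_system e1 e2" and rep: "\<And>x. \<exists>x1 x2. x = x1 *\<^sub>R e1 + x2 *\<^sub>R e2"
    and a: "facet_normal a"
  shows "slope e1 e2 (unit_ball nrm \<inter> {x. a \<bullet> x = 1})
       = (if a \<bullet> e2 = 0 then \<infinity> else ereal (- (a \<bullet> e1) / (a \<bullet> e2)))"
proof -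
  let ?F = "unit_ball nrm \<inter> {x. a \<bullet> x = 1}"
  have "aff_dim ?F = 1" "?F \<noteq> {}"
    using a aff_dim_unit_ball by (auto simp: facet_normal_def facet_of_def)
  then obtain p where p: "p \<in> ?F" by blast
  have "?F \<noteq> {p}" using \<open>aff_dim ?F = 1\<close> by (metis aff_dim_sing zero_neq_one)
  then obtain q where q: "q \<in> ?F" "p \<noteq> q" using p by blast
  have sub: "?F \<subseteq> coord_line e1 e2 (a \<bullet> e1) (a \<bullet> e2) (- 1)"
  proof
    fix x assume x: "x \<in> ?F"
    obtain x1 x2 where "x = x1 *\<^sub>R e1 + x2 *\<^sub>R e2" using rep by blast
    with x show "x \<in> coord_line e1 e2 (a \<bullet> e1) (a \<bullet> e2) (- 1)"
      unfolding coord_line_def by (auto simp: inner_add_right mult.commute)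
  qed
  have "a \<bullet> e1 \<noteq> 0 \<or> a \<bullet> e2 \<noteq> 0"
  proof (rule ccontr)
    assume "\<not> ?thesis"
    with sub p show False by (auto simp: coord_line_def)
  qed
  hence "has_slope e1 e2 ?F (if a \<bullet> e2 = 0 then \<infinity> else ereal (- (a \<bullet> e1) / (a \<bullet> e2)))"
    unfolding has_slope_def using sub by blast
  thus ?thesis by (rule slope_eq[OF cs p q])
qed

text \<open>The hypothesis is used twice. In coordinates dual to two non-parallel normals it yields
  a third normal with both components nonzero. Rescaling turns this one into \<open>p1 + p2\<close>,
  and in the rescaled coordinates the hypothesis yields the fourth form.\<close>

lemma transcendental_normals:
  assumes noalg: "\<not> (\<exists>e1 e2. coordinate_system e1 e2 \<and>
              (\<forall>I \<in> sides (unit_ball nrm). algebraic_slope (slope e1 e2 I)))"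
  obtains p1 p2 u1 u2 :: "real ^ 2" and \<alpha> :: real
  where "p1 \<bullet> u1 = 1" "p1 \<bullet> u2 = 0" "p2 \<bullet> u1 = 0" "p2 \<bullet> u2 = 1"
    "\<And>x. x = (p1 \<bullet> x) *\<^sub>R u1 + (p2 \<bullet> x) *\<^sub>R u2" "\<not> algebraic \<alpha>"
    "norming nrm p1" "norming nrm p2" "norming nrm (p1 + p2)" "norming nrm (p1 + \<alpha> *\<^sub>R p2)"
proof -
  have trans: "\<exists>a. facet_normal a \<and> a \<bullet> e2 \<noteq> 0 \<and> \<not> algebraic ((a \<bullet> e1) / (a \<bullet> e2))"
    if dual: "b1 \<bullet> e1 = 1" "b2 \<bullet> e1 = 0" "b2 \<bullet> e2 = 1"
      and rep: "\<And>x. x = (b1 \<bullet> x) *\<^sub>R e1 + (b2 \<bullet> x) *\<^sub>R e2" for b1 b2 e1 e2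
  proof -
    have cs: "coordinate_system e1 e2" using dual by (rule coordinate_system_if_dual)
    then obtain F where F: "F facet_of unit_ball nrm" "\<not> algebraic_slope (slope e1 e2 F)"
      using noalg by (auto simp: sides_def)
    obtain a where a: "facet_normal a" "F = unit_ball nrm \<inter> {x. a \<bullet> x = 1}"
      using facet_has_normal[OF F(1)] .
    have "slope e1 e2 F = (if a \<bullet> e2 = 0 then \<infinity> else ereal (- (a \<bullet> e1) / (a \<bullet> e2)))"
      unfolding a(2) using cs rep a(1) by (intro slope_of_facet) blast+
    with F(2) a(1) show ?thesis
      by (intro exI[of _ a]) (auto simp: algebraic_slope_def split: if_splits)
  qed
  obtain a1 where a1: "facet_normal a1"
  proof -
    have "nrm ((1 / nrm (axis 1 1)) *\<^sub>R axis 1 1) = 1"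
      by (rule nrm_normalize) (simp add: axis_eq_0_iff)
    then obtain F where "F facet_of unit_ball nrm" by (rule exists_facet_through)
    thus ?thesis using that facet_has_normal by metis
  qed
  have "a1 \<noteq> 0" using a1 by (auto simp: facet_normal_def facet_of_def)
  \<comment> \<open>\<open>w\<close> is orthogonal to \<open>a1\<close>. A facet in direction
    \<open>w\<close> has a normal that is not orthogonal to \<open>w\<close>, hence not parallel to
    \<open>a1\<close>.\<close>
  define w :: "real ^ 2" where "w = vector [- a1 $ 2, a1 $ 1]"
  have "w \<noteq> 0" using \<open>a1 \<noteq> 0\<close> by (auto simp: w_def vec_eq_iff forall_2)
  obtain F where F: "F facet_of unit_ball nrm" "(1 / nrm w) *\<^sub>R w \<in> F"
    using exists_facet_through[OF nrm_normalize[OF \<open>w \<noteq> 0\<close>]] .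
  obtain a2 where a2: "facet_normal a2" "F = unit_ball nrm \<inter> {x. a2 \<bullet> x = 1}"
    using facet_has_normal[OF F(1)] .
  have "a2 \<bullet> w \<noteq> 0"
  proof
    assume "a2 \<bullet> w = 0"
    hence "a2 \<bullet> ((1 / nrm w) *\<^sub>R w) = 0" by simp
    with F(2) a2(2) show False by force
  qed
  hence "a1 $ 1 * a2 $ 2 \<noteq> a1 $ 2 * a2 $ 1"
    by (simp add: w_def inner_vec_def sum_2 mult.commute)
  then obtain v1 v2 where v: "a1 \<bullet> v1 = 1" "a1 \<bullet> v2 = 0" "a2 \<bullet> v1 = 0" "a2 \<bullet> v2 = 1"
    "\<And>x. x = (a1 \<bullet> x) *\<^sub>R v1 + (a2 \<bullet> x) *\<^sub>R v2"
    using dual_basis_exists by metis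
  obtain a3 where a3: "facet_normal a3" "a3 \<bullet> v2 \<noteq> 0" "\<not> algebraic ((a3 \<bullet> v1) / (a3 \<bullet> v2))"
    using trans[OF v(1,3,4,5)] by blast
  define s t where "s = a3 \<bullet> v1" and "t = a3 \<bullet> v2"
  have st: "s \<noteq> 0" "t \<noteq> 0" using a3(2,3) by (auto simp: s_def t_def)
  define p1 p2 u1 u2 where "p1 = s *\<^sub>R a1" and "p2 = t *\<^sub>R a2" and
    "u1 = (1 / s) *\<^sub>R v1" and "u2 = (1 / t) *\<^sub>R v2"
  have dual: "p1 \<bullet> u1 = 1" "p1 \<bullet> u2 = 0" "p2 \<bullet> u1 = 0" "p2 \<bullet> u2 = 1"
    using st v(1-4) by (simp_all add: p1_def p2_def u1_def u2_def)
  have rep: "x = (p1 \<bullet> x) *\<^sub>R u1 + (p2 \<bullet> x) *\<^sub>R u2" for x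
    using v(5)[of x] st by (simp add: p1_def p2_def u1_def u2_def)
  have rep': "a = (a \<bullet> u1) *\<^sub>R p1 + (a \<bullet> u2) *\<^sub>R p2" for a
  proof -
    have "a \<bullet> x = ((a \<bullet> u1) *\<^sub>R p1 + (a \<bullet> u2) *\<^sub>R p2) \<bullet> x" for x
      by (subst rep[of x]) (simp add: inner_add_left inner_add_right dual mult.commute)
    thus ?thesis using vector_eq_rdot by blast
  qed
  have "a3 \<bullet> u1 = 1" "a3 \<bullet> u2 = 1" using st by (simp_all add: u1_def u2_def s_def t_def)
  hence a3_eq: "a3 = p1 + p2" using rep'[of a3] by simp
  obtain a4 where a4: "facet_normal a4" "a4 \<bullet> u2 \<noteq> 0" "\<not> algebraic ((a4 \<bullet> u1) / (a4 \<bullet> u2))"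
    using trans[OF dual(1,3,4) rep] by blast
  have "a4 \<bullet> u1 \<noteq> 0" using a4(3) by auto
  \<comment> \<open>Scaling to first component \<open>1\<close> produces the reciprocal of the
    transcendental ratio, which is again transcendental.\<close>
  define \<alpha> where "\<alpha> = (a4 \<bullet> u2) / (a4 \<bullet> u1)"
  have "\<not> algebraic \<alpha>" using a4(3) algebraic_inverse[of \<alpha>] by (auto simp: \<alpha>_def)
  have a4_eq: "(1 / (a4 \<bullet> u1)) *\<^sub>R a4 = p1 + \<alpha> *\<^sub>R p2"
    by (subst rep'[of a4]) (use \<open>a4 \<bullet> u1 \<noteq> 0\<close> in \<open>simp add: \<alpha>_def scaleR_add_right\<close>)
  show ?thesis
  proof (rule that[OF dual rep \<open>\<not> algebraic \<alpha>\<close>])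
    show "norming nrm p1" "norming nrm p2"
      unfolding p1_def p2_def using st a1 a2(1) by (auto intro: norming_scaleR facet_normal_norming)
    show "norming nrm (p1 + p2)" using facet_normal_norming[OF a3(1)] by (simp add: a3_eq)
    show "norming nrm (p1 + \<alpha> *\<^sub>R p2)"
      unfolding a4_eq[symmetric]
      using \<open>a4 \<bullet> u1 \<noteq> 0\<close> by (intro norming_scaleR facet_normal_norming a4) simp
  qed
qed

subsection \<open>Distances in well-distributed sets\<close>

context
  fixes S :: "(real ^ 2) set" and s :: "real ^ 2 \<Rightarrow> real ^ 2" and K :: real
  assumes s_in: "s x \<in> S" and s_near: "nrm (x - s x) \<le> K"
begin

lemma nrm_near_point_le: "nrm (s x) \<le> nrm x + K"
  using nrm_triangle[of x "s x - x"] s_near[of x] nrm_minus_commute[of x "s x"] by simp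

text \<open>Replacing a point by its neighbour in \<open>S\<close> changes \<open>p\<close> by at
  most \<open>C * K\<close>, so a gap above \<open>2 * (C * K)\<close> keeps its sign.\<close>

lemma inner_near_points_less:
  assumes C: "\<And>x. \<bar>p \<bullet> x\<bar> \<le> C * nrm x" "C \<ge> 0" and "p \<bullet> x + 2 * (C * K) < p \<bullet> y"
  shows "p \<bullet> s x < p \<bullet> s y"
proof -
  have "\<bar>p \<bullet> (z - s z)\<bar> \<le> C * K" for z
    using C(1)[of "z - s z"] mult_left_mono[OF s_near[of z] C(2)] by linarith
  from this[of x] this[of y] assms(3) show ?thesis by (simp add: inner_diff_right)
qed

text \<open>
  If \<open>nrm = c * (p \<bullet> _)\<close> near \<open>v\<close>, the distances between \<open>A\<close> and points of \<open>S\<close> near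
  \<open>(N / 2) v\<close> are multiples of differences of values of \<open>p\<close>.
\<close>

lemma norming_differences:
  assumes norming: "norming nrm p" and C: "\<And>x. \<bar>p \<bullet> x\<bar> \<le> C * nrm x" "C \<ge> 0"
    and \<sigma>: "\<sigma> > 2 * (C * K)" "\<sigma> > 0" and u: "p \<bullet> u = 1" "nrm u \<le> U" and "U > 0"
  obtains c N0 :: real where "c > 0" "\<And>N n A. N0 \<le> real N \<Longrightarrow> real n \<le> c * N \<Longrightarrow> finite A \<Longrightarrow> A \<subseteq> S \<Longrightarrow>
      (\<And>a. a \<in> A \<Longrightarrow> nrm a \<le> K + \<sigma> * n * U) \<Longrightarrow> finite (distance_set nrm N S) \<Longrightarrow>
      \<exists>B. finite B \<and> n \<le> card B \<and> card (diff_set B ((\<bullet>) p ` A)) \<le> card (distance_set nrm N S)"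
proof -
  obtain c v e0 where c: "c \<noteq> 0" and v: "nrm v = 1" and e0: "e0 > 0"
    "\<And>w. nrm (w - v) \<le> e0 \<Longrightarrow> nrm w = c * (p \<bullet> w)"
    using norming unfolding norming_def by blast
  define e where "e = min e0 1"
  have e: "e > 0" "e \<le> 1" "\<And>w. nrm (w - v) \<le> e \<Longrightarrow> nrm w = c * (p \<bullet> w)"
    using e0 by (auto simp: e_def)
  \<comment> \<open>Chosen so that \<open>2 * (\<sigma> * n * U)\<close> takes up at most half of
    the room \<open>e * N / 2\<close>; the lower bound on \<open>N\<close> leaves the other half for
    \<open>2 * K\<close>.\<close>
  define c1 where "c1 = e / (8 * \<sigma> * U)"
  show ?thesis
  proof (rule that[of c1 "max 1 (8 * K / e)"])
    show "c1 > 0" using e(1) \<sigma>(2) \<open>U > 0\<close> by (simp add: c1_def)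
    fix N n :: nat and A
    assume N: "max 1 (8 * K / e) \<le> real N" and n: "real n \<le> c1 * N" and A: "finite A" "A \<subseteq> S"
      "\<And>a. a \<in> A \<Longrightarrow> nrm a \<le> K + \<sigma> * n * U" and fin: "finite (distance_set nrm N S)"
    define L where "L = real N / 2"
    have "L > 0" using N by (simp add: L_def)
    have "8 * K \<le> e * N" using N e(1) by (simp add: field_simps)
    moreover have "8 * (\<sigma> * n * U) \<le> e * N"
      using n \<sigma>(2) \<open>U > 0\<close> by (simp add: c1_def field_simps)
    moreover have "L * e = e * N / 2" by (simp add: L_def)
    ultimately have small: "2 * K + 2 * (\<sigma> * n * U) \<le> L * e" by linarith
    \<comment> \<open>Points of \<open>S\<close> near a progression in direction \<open>u\<close>
      starting at \<open>L v\<close>. The spacing \<sigma> keeps their values under \<open>p\<close>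
      strictly increasing, which gives \<open>n\<close> elements of \<open>B\<close>.\<close>
    define b where "b = (\<lambda>i::nat. s (L *\<^sub>R v + (\<sigma> * i) *\<^sub>R u))"
    define B where "B = (\<lambda>i. p \<bullet> b i) ` {..<n}"
    have less: "p \<bullet> b i < p \<bullet> b j" if "i < j" for i j
    proof -
      have "\<sigma> * (real i + 1) \<le> \<sigma> * real j" using that \<sigma>(2) by (intro mult_left_mono) auto
      hence "\<sigma> * real i + 2 * (C * K) < \<sigma> * real j" using \<sigma>(1) by (simp add: algebra_simps)
      thus ?thesis unfolding b_def
        by (intro inner_near_points_less[OF C]) (simp add: inner_add_right u(1))
    qed
    hence "strict_mono (\<lambda>i. p \<bullet> b i)" by (simp add: strict_mono_def)
    hence "inj (\<lambda>i. p \<bullet> b i)" by (rule strict_mono_imp_inj_on)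
    hence "inj_on (\<lambda>i. p \<bullet> b i) {..<n}" by (rule inj_on_subset) simp
    hence "card B = n" unfolding B_def by (simp add: card_image)
    moreover have "diff_set B ((\<bullet>) p ` A) \<subseteq> (\<lambda>t. t / c) ` distance_set nrm N S"
    proof
      fix x assume "x \<in> diff_set B ((\<bullet>) p ` A)"
      then obtain i a where ia: "i < n" "a \<in> A" "x = p \<bullet> b i - p \<bullet> a"
        by (auto simp: B_def elim!: diff_setE)
      define w where "w = b i - a"
      \<comment> \<open>The offset along \<open>u\<close>, the point \<open>a\<close> and the error
        \<open>K\<close> are together small against \<open>L\<close>, so \<open>w / L\<close> falls
        in the region where \<open>nrm\<close> is \<open>c\<close> times the form.\<close>
      have "nrm (w - L *\<^sub>R v) \<le> L * e"
      proof -
        define z where "z = L *\<^sub>R v + (\<sigma> * i) *\<^sub>R u"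
        have eq: "w - L *\<^sub>R v = (s z - z) + ((\<sigma> * i) *\<^sub>R u + (- a))"
          by (simp add: w_def b_def z_def)
        have "nrm (w - L *\<^sub>R v) \<le> nrm (s z - z) + (nrm ((\<sigma> * i) *\<^sub>R u) + nrm (- a))"
          unfolding eq
          using nrm_triangle[of "s z - z" "(\<sigma> * i) *\<^sub>R u + (- a)"] nrm_triangle[of "(\<sigma> * i) *\<^sub>R u" "- a"]
          by linarith
        moreover have "nrm (s z - z) \<le> K" using s_near[of z] nrm_minus_commute[of z] by simp
        moreover have "nrm ((\<sigma> * i) *\<^sub>R u) \<le> \<sigma> * n * U"
        proof -
          have "nrm ((\<sigma> * i) *\<^sub>R u) = \<sigma> * real i * nrm u" using \<sigma>(2) by (simp add: nrm_scaleR)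
          also have "\<dots> \<le> \<sigma> * n * U" using \<sigma>(2) ia(1) u(2) by (intro mult_mono) simp_all
          finally show ?thesis .
        qed
        moreover have "nrm (- a) \<le> K + \<sigma> * n * U" using A(3)[OF ia(2)] by (simp add: nrm_minus)
        ultimately show ?thesis using small by linarith
      qed
      have "(1 / L) *\<^sub>R w - v = (1 / L) *\<^sub>R (w - L *\<^sub>R v)"
        using \<open>L > 0\<close> by (simp add: algebra_simps)
      hence "nrm ((1 / L) *\<^sub>R w - v) = \<bar>1 / L\<bar> * nrm (w - L *\<^sub>R v)" by (simp only: nrm_scaleR)
      also have "\<dots> \<le> \<bar>1 / L\<bar> * (L * e)"
        using \<open>nrm (w - L *\<^sub>R v) \<le> L * e\<close> by (intro mult_left_mono) simp_all
      also have "\<dots> = e" using \<open>L > 0\<close> by simp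
      finally have "nrm ((1 / L) *\<^sub>R w - v) \<le> e" .
      from e(3)[OF this] have w: "nrm w = c * (p \<bullet> w)"
        using \<open>L > 0\<close> by (simp add: nrm_scaleR)
      have "nrm w \<le> nrm (w - L *\<^sub>R v) + nrm (L *\<^sub>R v)" using nrm_triangle[of "w - L *\<^sub>R v" "L *\<^sub>R v"] by simp
      also have "\<dots> \<le> L * e + L" using \<open>nrm (w - L *\<^sub>R v) \<le> L * e\<close> \<open>L > 0\<close> v by (simp add: nrm_scaleR)
      also have "\<dots> \<le> L * 1 + L" using \<open>L > 0\<close> e(2) by (intro add_right_mono mult_left_mono) simp_all
      finally have "nrm w \<le> N" by (simp add: L_def)
      hence "nrm w \<in> distance_set nrm N S"
        using s_in A(2) ia(2) unfolding distance_set_def w_def b_def by blast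
      moreover have "x = nrm w / c" using c w ia(3) by (simp add: w_def inner_diff_right)
      ultimately show "x \<in> (\<lambda>t. t / c) ` distance_set nrm N S" by blast
    qed
    hence "card (diff_set B ((\<bullet>) p ` A)) \<le> card (distance_set nrm N S)"
      using fin by (meson card_image_le card_mono finite_imageI order_trans)
    ultimately show "\<exists>B. finite B \<and> n \<le> card B \<and> card (diff_set B ((\<bullet>) p ` A)) \<le> card (distance_set nrm N S)"
      by (intro exI[of _ B]) (auto simp: B_def)
  qed
qed

text \<open>Points of \<open>S\<close> near a \<open>2 n\<close> by \<open>2 n\<close> lattice with
  mesh \<sigma> form \<open>A\<close>. Those with nonnegative indices form \<open>A0\<close>, and
  negative indices supply the \<open>n\<close> values below those of \<open>A0\<close> in each
  coordinate.\<close>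

lemma distance_set_bound:
  assumes noalg: "\<not> (\<exists>e1 e2. coordinate_system e1 e2 \<and>
              (\<forall>I \<in> sides (unit_ball nrm). algebraic_slope (slope e1 e2 I)))"
  obtains c N0 :: real where "c > 0" "\<And>N n. N0 \<le> real N \<Longrightarrow> real n \<le> c * N \<Longrightarrow> n > 0 \<Longrightarrow>
    finite (distance_set nrm N S) \<Longrightarrow>
    n \<le> card (distance_set nrm N S) \<and>
    ln (real n) \<le> 13 * (card (distance_set nrm N S) / n) * ln (card (distance_set nrm N S) / n)"
proof -
  obtain p1 p2 u1 u2 \<alpha> where dual: "p1 \<bullet> u1 = 1" "p1 \<bullet> u2 = 0" "p2 \<bullet> u1 = 0" "p2 \<bullet> u2 = 1"
    and rep: "\<And>x. x = (p1 \<bullet> x) *\<^sub>R u1 + (p2 \<bullet> x) *\<^sub>R u2" and nonalg: "\<not> algebraic \<alpha>"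
    and norming: "norming nrm p1" "norming nrm p2" "norming nrm (p1 + p2)" "norming nrm (p1 + \<alpha> *\<^sub>R p2)"
    by (rule transcendental_normals[OF noalg]) blast
  obtain C1 where C1: "C1 > 0" "\<And>x. \<bar>p1 \<bullet> x\<bar> \<le> C1 * nrm x" by (rule inner_le_nrm) blast
  obtain C2 where C2: "C2 > 0" "\<And>x. \<bar>p2 \<bullet> x\<bar> \<le> C2 * nrm x" by (rule inner_le_nrm) blast
  obtain C3 where C3: "C3 > 0" "\<And>x. \<bar>(p1 + p2) \<bullet> x\<bar> \<le> C3 * nrm x" by (rule inner_le_nrm) blast
  obtain C4 where C4: "C4 > 0" "\<And>x. \<bar>(p1 + \<alpha> *\<^sub>R p2) \<bullet> x\<bar> \<le> C4 * nrm x" by (rule inner_le_nrm) blast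
  have "K \<ge> 0" using s_near[of 0] nrm_nonneg[of "0 - s 0"] by linarith
  define \<sigma> where "\<sigma> = 2 * (C1 * K) + 2 * (C2 * K) + 2 * (C3 * K) + 2 * (C4 * K) + 1"
  have CK: "C1 * K \<ge> 0" "C2 * K \<ge> 0" "C3 * K \<ge> 0" "C4 * K \<ge> 0"
    using C1 C2 C3 C4 \<open>K \<ge> 0\<close> by simp_all
  have \<sigma>: "\<sigma> > 0" "\<sigma> > 2 * (C1 * K)" "\<sigma> > 2 * (C2 * K)" "\<sigma> > 2 * (C3 * K)" "\<sigma> > 2 * (C4 * K)"
    using CK by (simp_all add: \<sigma>_def)
  define U where "U = nrm u1 + nrm u2"
  have "u1 \<noteq> 0" using dual by auto
  hence U: "nrm u1 \<le> U" "nrm u2 \<le> U" "U > 0" using nrm_pos[of u1] by (auto simp: U_def add_pos_nonneg)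
  \<comment> \<open>The direction \<open>u1\<close> has value \<open>1\<close> under three of the
    forms, so only \<open>p2\<close> needs \<open>u2\<close>.\<close>
  have u34: "(p1 + p2) \<bullet> u1 = 1" "(p1 + \<alpha> *\<^sub>R p2) \<bullet> u1 = 1" using dual by (simp_all add: inner_add_left)
  note diffs = norming_differences[where \<sigma> = \<sigma> and U = U]
  obtain c1 N1 :: real where 1: "c1 > 0" "\<And>N n A. N1 \<le> real N \<Longrightarrow> real n \<le> c1 * N \<Longrightarrow> finite A \<Longrightarrow> A \<subseteq> S \<Longrightarrow>
      (\<And>a. a \<in> A \<Longrightarrow> nrm a \<le> K + \<sigma> * n * U) \<Longrightarrow> finite (distance_set nrm N S) \<Longrightarrow>
      \<exists>B. finite B \<and> n \<le> card B \<and> card (diff_set B ((\<bullet>) p1 ` A)) \<le> card (distance_set nrm N S)"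
    using diffs[OF norming(1) C1(2) less_imp_le[OF C1(1)] \<sigma>(2,1) dual(1) U(1,3)] by blast
  obtain c2 N2 :: real where 2: "c2 > 0" "\<And>N n A. N2 \<le> real N \<Longrightarrow> real n \<le> c2 * N \<Longrightarrow> finite A \<Longrightarrow> A \<subseteq> S \<Longrightarrow>
      (\<And>a. a \<in> A \<Longrightarrow> nrm a \<le> K + \<sigma> * n * U) \<Longrightarrow> finite (distance_set nrm N S) \<Longrightarrow>
      \<exists>B. finite B \<and> n \<le> card B \<and> card (diff_set B ((\<bullet>) p2 ` A)) \<le> card (distance_set nrm N S)"
    using diffs[OF norming(2) C2(2) less_imp_le[OF C2(1)] \<sigma>(3,1) dual(4) U(2,3)] by blast
  obtain c3 N3 :: real where 3: "c3 > 0" "\<And>N n A. N3 \<le> real N \<Longrightarrow> real n \<le> c3 * N \<Longrightarrow> finite A \<Longrightarrow> A \<subseteq> S \<Longrightarrow>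
      (\<And>a. a \<in> A \<Longrightarrow> nrm a \<le> K + \<sigma> * n * U) \<Longrightarrow> finite (distance_set nrm N S) \<Longrightarrow>
      \<exists>B. finite B \<and> n \<le> card B \<and> card (diff_set B ((\<bullet>) (p1 + p2) ` A)) \<le> card (distance_set nrm N S)"
    using diffs[OF norming(3) C3(2) less_imp_le[OF C3(1)] \<sigma>(4,1) u34(1) U(1,3)] by blast
  obtain c4 N4 :: real where 4: "c4 > 0" "\<And>N n A. N4 \<le> real N \<Longrightarrow> real n \<le> c4 * N \<Longrightarrow> finite A \<Longrightarrow> A \<subseteq> S \<Longrightarrow>
      (\<And>a. a \<in> A \<Longrightarrow> nrm a \<le> K + \<sigma> * n * U) \<Longrightarrow> finite (distance_set nrm N S) \<Longrightarrow>
      \<exists>B. finite B \<and> n \<le> card B \<and> card (diff_set B ((\<bullet>) (p1 + \<alpha> *\<^sub>R p2) ` A)) \<le> card (distance_set nrm N S)"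
    using diffs[OF norming(4) C4(2) less_imp_le[OF C4(1)] \<sigma>(5,1) u34(2) U(1,3)] by blast
  define c where "c = min (min c1 c2) (min c3 c4)"
  define N0 where "N0 = max (max N1 N2) (max N3 N4)"
  show ?thesis
  proof (rule that[of c N0])
    show "c > 0" using 1(1) 2(1) 3(1) 4(1) by (simp add: c_def)
    fix N n :: nat
    assume N: "N0 \<le> real N" and n: "real n \<le> c * N" "n > 0" and fin: "finite (distance_set nrm N S)"
    have ns: "real n \<le> c1 * N" "real n \<le> c2 * N" "real n \<le> c3 * N" "real n \<le> c4 * N"
      using n(1) mult_right_mono[of c _ "real N"] by (auto simp: c_def intro: order_trans)
    have Ns: "N1 \<le> N" "N2 \<le> N" "N3 \<le> N" "N4 \<le> N" using N by (auto simp: N0_def)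
    define x :: "int \<times> int \<Rightarrow> real ^ 2" where
      "x = (\<lambda>(i, j). (\<sigma> * of_int i) *\<^sub>R u1 + (\<sigma> * of_int j) *\<^sub>R u2)"
    define g where "g = (\<lambda>ij. s (x ij))"
    define m where "m = int n"
    define A A0 where "A = g ` ({-m..<m} \<times> {-m..<m})" and "A0 = g ` ({0..<m} \<times> {0..<m})"
    have step: "\<sigma> * of_int i + \<sigma> \<le> \<sigma> * of_int j" if "i < j" for i j :: int
    proof -
      have "\<sigma> * (of_int i + 1) \<le> \<sigma> * of_int j" using that \<sigma>(1) by (intro mult_left_mono) auto
      thus ?thesis by (simp add: algebra_simps)
    qed
    have less1: "p1 \<bullet> g ij < p1 \<bullet> g kl" if "fst ij < fst kl" for ij kl
      unfolding g_def
    proof (rule inner_near_points_less[OF C1(2) less_imp_le[OF C1(1)]])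
      show "p1 \<bullet> x ij + 2 * (C1 * K) < p1 \<bullet> x kl"
        using step[OF that] \<sigma>(2) by (simp add: x_def case_prod_beta inner_add_right dual)
    qed
    have less2: "p2 \<bullet> g ij < p2 \<bullet> g kl" if "snd ij < snd kl" for ij kl
      unfolding g_def
    proof (rule inner_near_points_less[OF C2(2) less_imp_le[OF C2(1)]])
      show "p2 \<bullet> x ij + 2 * (C2 * K) < p2 \<bullet> x kl"
        using step[OF that] \<sigma>(3) by (simp add: x_def case_prod_beta inner_add_right dual)
    qed
    have inj_g: "inj g"
    proof (rule injI)
      fix ij kl assume eq: "g ij = g kl"
      have "fst ij = fst kl" using less1[of ij kl] less1[of kl ij] eq by (metis less_irrefl linorder_less_linear)
      moreover have "snd ij = snd kl"
        using less2[of ij kl] less2[of kl ij] eq by (metis less_irrefl linorder_less_linear)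
      ultimately show "ij = kl" by (simp add: prod_eq_iff)
    qed
    have "finite A" "A \<subseteq> S" "A0 \<subseteq> A" using s_in by (auto simp: A_def A0_def g_def)
    have "card A0 = card ({0..<m} \<times> {0..<m})"
      unfolding A0_def using inj_g by (intro card_image) (rule inj_on_subset, auto)
    hence cardA0: "n ^ 2 \<le> card A0" by (simp add: m_def card_cartesian_product power2_eq_square)
    have nrm_x: "nrm (x (i, j)) \<le> \<sigma> * n * U" if "i \<in> {-m..<m}" "j \<in> {-m..<m}" for i j
    proof -
      have le: "\<bar>real_of_int k\<bar> \<le> n" if "k \<in> {-m..<m}" for k
        using that by (auto simp: m_def abs_le_iff)
      have "nrm (x (i, j)) \<le> nrm ((\<sigma> * of_int i) *\<^sub>R u1) + nrm ((\<sigma> * of_int j) *\<^sub>R u2)"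
        unfolding x_def by (simp add: nrm_triangle)
      also have "\<dots> = \<sigma> * \<bar>of_int i\<bar> * nrm u1 + \<sigma> * \<bar>of_int j\<bar> * nrm u2"
        using \<sigma>(1) by (simp add: nrm_scaleR abs_mult)
      also have "\<dots> \<le> \<sigma> * n * nrm u1 + \<sigma> * n * nrm u2"
        using le that \<sigma>(1) by (intro add_mono mult_right_mono mult_left_mono) auto
      finally show ?thesis by (simp add: U_def algebra_simps)
    qed
    have nrm_A: "nrm a \<le> K + \<sigma> * n * U" if "a \<in> A" for a
    proof -
      from that obtain i j where ij: "i \<in> {-m..<m}" "j \<in> {-m..<m}" "a = s (x (i, j))"
        by (auto simp: A_def g_def)
      show ?thesis using nrm_near_point_le[of "x (i, j)"] nrm_x[OF ij(1,2)] ij(3) by simp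
    qed
    have inj12: "inj_on (\<lambda>a. (p1 \<bullet> a, p2 \<bullet> a)) A"
      using rep by (metis (no_types, lifting) inj_onI prod.inject)
    have below1: "n \<le> card {b \<in> (\<bullet>) p1 ` A. \<forall>y\<in>(\<bullet>) p1 ` A0. b < y}"
    proof -
      have "inj_on (\<lambda>i. p1 \<bullet> g (i, 0)) {-m..<0}"
        using less1 by (intro linorder_inj_onI) (auto simp: less_le)
      moreover have "(\<lambda>i. p1 \<bullet> g (i, 0)) ` {-m..<0} \<subseteq> {b \<in> (\<bullet>) p1 ` A. \<forall>y\<in>(\<bullet>) p1 ` A0. b < y}"
        using less1 n(2) by (auto simp: A_def A0_def m_def)
      ultimately have "card {-m..<0} \<le> card {b \<in> (\<bullet>) p1 ` A. \<forall>y\<in>(\<bullet>) p1 ` A0. b < y}"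
        using \<open>finite A\<close> by (intro card_inj_on_le) auto
      thus ?thesis by (simp add: m_def)
    qed
    have below2: "n \<le> card {b \<in> (\<bullet>) p2 ` A. \<forall>y\<in>(\<bullet>) p2 ` A0. b < y}"
    proof -
      have "inj_on (\<lambda>i. p2 \<bullet> g (0, i)) {-m..<0}"
        using less2 by (intro linorder_inj_onI) (auto simp: less_le)
      moreover have "(\<lambda>i. p2 \<bullet> g (0, i)) ` {-m..<0} \<subseteq> {b \<in> (\<bullet>) p2 ` A. \<forall>y\<in>(\<bullet>) p2 ` A0. b < y}"
        using less2 n(2) by (auto simp: A_def A0_def m_def)
      ultimately have "card {-m..<0} \<le> card {b \<in> (\<bullet>) p2 ` A. \<forall>y\<in>(\<bullet>) p2 ` A0. b < y}"
        using \<open>finite A\<close> by (intro card_inj_on_le) auto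
      thus ?thesis by (simp add: m_def)
    qed
    let ?D = "card (distance_set nrm N S)"
    obtain B1 where B1: "finite B1" "n \<le> card B1" "card (diff_set B1 ((\<bullet>) p1 ` A)) \<le> ?D"
      using 1(2)[OF Ns(1) ns(1) \<open>finite A\<close> \<open>A \<subseteq> S\<close> nrm_A fin] by blast
    obtain B2 where B2: "finite B2" "n \<le> card B2" "card (diff_set B2 ((\<bullet>) p2 ` A)) \<le> ?D"
      using 2(2)[OF Ns(2) ns(2) \<open>finite A\<close> \<open>A \<subseteq> S\<close> nrm_A fin] by blast
    obtain B3 where B3: "finite B3" "n \<le> card B3" "card (diff_set B3 ((\<bullet>) (p1 + p2) ` A)) \<le> ?D"
      using 3(2)[OF Ns(3) ns(3) \<open>finite A\<close> \<open>A \<subseteq> S\<close> nrm_A fin] by blast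
    obtain B4 where B4: "finite B4" "n \<le> card B4" "card (diff_set B4 ((\<bullet>) (p1 + \<alpha> *\<^sub>R p2) ` A)) \<le> ?D"
      using 4(2)[OF Ns(4) ns(4) \<open>finite A\<close> \<open>A \<subseteq> S\<close> nrm_A fin] by blast
    have eqs: "(\<bullet>) (p1 + p2) = (\<lambda>a. p1 \<bullet> a + p2 \<bullet> a)"
      "(\<bullet>) (p1 + \<alpha> *\<^sub>R p2) = (\<lambda>a. p1 \<bullet> a + \<alpha> * (p2 \<bullet> a))"
      by (auto simp: inner_add_left)
    note count = four_projections_bound[OF nonalg \<open>finite A\<close> \<open>A0 \<subseteq> A\<close> n(2) cardA0 inj12 below1 below2
      B1(1) B2(1) B3(1) B4(1) B1(2) B2(2) B3(2) B4(2) B1(3) B2(3) B3(3)[unfolded eqs] B4(3)[unfolded eqs]]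
    show "n \<le> ?D \<and> ln (real n) \<le> 13 * (?D / n) * ln (?D / n)"
      by (rule conjI[OF count(2) log_bound_from_power_bound[OF count n(2)]])
  qed
qed

end
end

section \<open>Growth rate and conclusion\<close>

text \<open>With \<open>l = D / n\<close> and \<open>L = ln (ln N)\<close>, a value
  \<open>l < ln N / (26 * L)\<close> would give \<open>ln l \<le> L\<close>, hence
  \<open>13 * l * ln l < ln N / 2\<close>. But \<open>ln n\<close> is at least
  \<open>ln N + ln (c / 2)\<close>, which is no less than \<open>ln N / 2\<close> for large
  \<open>N\<close>. The constant \<open>52 = 2 * 26\<close> also pays for
  \<open>n \<ge> c * N / 2\<close>.\<close>

lemma growth_from_log_bound:
  fixes c :: real
  assumes "c > 0"
  shows "eventually (\<lambda>N. \<exists>n>0. real n \<le> c * real N \<and>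
    (\<forall>D. n \<le> D \<longrightarrow> ln (real n) \<le> 13 * (real D / real n) * ln (real D / real n) \<longrightarrow>
      c / 52 * (real N * ln (real N) / ln (ln (real N))) \<le> real D)) sequentially"
proof -
  have ln_top: "filterlim (\<lambda>N. ln (real N)) at_top sequentially"
    by (intro filterlim_compose[OF ln_at_top] filterlim_real_sequentially)
  \<comment> \<open>These thresholds make \<open>ln (c / 2)\<close> at least
    \<open>- ln N / 2\<close>, \<open>ln (ln N)\<close> at least \<open>1\<close>, and
    \<open>c * N\<close> at least \<open>2\<close>, so that rounding down loses at most
    half.\<close>
  have "eventually (\<lambda>N. - 2 * ln (c / 2) \<le> ln (real N)) sequentially"
    "eventually (\<lambda>N. exp 1 \<le> ln (real N)) sequentially"
    "eventually (\<lambda>N. 2 / c \<le> real N) sequentially"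
    using ln_top filterlim_real_sequentially by (auto simp: filterlim_at_top)
  thus ?thesis
  proof eventually_elim
    case (elim N)
    define n where "n = nat \<lfloor>c * real N\<rfloor>"
    have "c * real N \<ge> 2" using elim(3) assms by (simp add: field_simps)
    hence n: "real n \<le> c * real N" "c * real N / 2 \<le> real n" by (simp_all add: n_def) linarith+
    have "n > 0" using n(2) \<open>c * real N \<ge> 2\<close> by (intro Nat.gr0I) auto
    have "N > 0" using \<open>c * real N \<ge> 2\<close> by (intro Nat.gr0I) auto
    define L where "L = ln (ln (real N))"
    have "ln (real N) > 0" using elim(2) exp_gt_zero[of "1 :: real"] by linarith
    have "L \<ge> 1" unfolding L_def using elim(2) \<open>ln (real N) > 0\<close> by (simp add: ln_ge_iff)
    have "c / 52 * (real N * ln (real N) / L) \<le> real D"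
      if D: "n \<le> D" "ln (real n) \<le> 13 * (real D / real n) * ln (real D / real n)" for D
    proof -
      define l where "l = real D / real n"
      have "l \<ge> 1" using D(1) \<open>n > 0\<close> by (simp add: l_def)
      have "l \<ge> ln (real N) / (26 * L)"
      proof (rule ccontr)
        assume "\<not> ?thesis"
        hence l: "26 * (l * L) < ln (real N)" using \<open>L \<ge> 1\<close> by (simp add: field_simps)
        have "l * 1 \<le> l * L" using \<open>L \<ge> 1\<close> \<open>l \<ge> 1\<close> by (intro mult_left_mono) auto
        hence "l \<le> ln (real N)" using l \<open>l \<ge> 1\<close> by linarith
        hence "ln l \<le> L" using \<open>l \<ge> 1\<close> by (simp add: L_def)
        hence "l * ln l \<le> l * L" using \<open>l \<ge> 1\<close> by (intro mult_left_mono) auto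
        hence "ln (real n) < ln (real N) / 2" using D(2) l by (simp add: l_def[symmetric])
        moreover have "ln (real n) \<ge> ln (c / 2 * real N)"
          using n(2) \<open>n > 0\<close> \<open>N > 0\<close> assms by simp
        moreover have "ln (c / 2 * real N) = ln (c / 2) + ln (real N)"
          using assms \<open>N > 0\<close> by (intro ln_mult_pos) auto
        ultimately show False using elim(1) by simp
      qed
      have "c / 52 * (real N * ln (real N) / L) = (c * real N / 2) * (ln (real N) / (26 * L))"
        using \<open>L \<ge> 1\<close> by (simp add: field_simps)
      also have "\<dots> \<le> real n * l"
        using n(2) \<open>l \<ge> ln (real N) / (26 * L)\<close> \<open>ln (real N) > 0\<close> \<open>L \<ge> 1\<close> by (intro mult_mono) auto
      also have "\<dots> = real D" using \<open>n > 0\<close> by (simp add: l_def)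
      finally show ?thesis .
    qed
    with \<open>n > 0\<close> n(1) show ?case by (auto simp: L_def)
  qed
qed

theorem theorem4:
  fixes nrm :: "real ^ 2 \<Rightarrow> real" and S :: "(real ^ 2) set"
  assumes "is_norm nrm"
    and "polytope (unit_ball nrm)"
    and "\<not> (\<exists>e1 e2. coordinate_system e1 e2 \<and>
              (\<forall>I \<in> sides (unit_ball nrm). algebraic_slope (slope e1 e2 I)))"
    and "well_distributed nrm S"
  shows "\<exists>c>0. \<forall>N::nat. N \<ge> 3 \<longrightarrow>
           ecard (distance_set nrm N S) \<ge> ereal (c * (real N * ln (real N) / ln (ln (real N))))"
proof -
  interpret polygonal_norm nrm by unfold_locales fact+
  obtain K where "\<forall>x. \<exists>y\<in>S. nrm (x - y) \<le> K" using assms(4) unfolding well_distributed_def by blast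
  then obtain s where s: "\<And>x. s x \<in> S" "\<And>x. nrm (x - s x) \<le> K" by metis
  obtain c N0 :: real where c: "c > 0" and bound: "\<And>N n. N0 \<le> real N \<Longrightarrow> real n \<le> c * N \<Longrightarrow> n > 0 \<Longrightarrow>
    finite (distance_set nrm N S) \<Longrightarrow>
    n \<le> card (distance_set nrm N S) \<and>
    ln (real n) \<le> 13 * (card (distance_set nrm N S) / n) * ln (card (distance_set nrm N S) / n)"
    by (rule distance_set_bound[OF s assms(3)]) blast
  define f where "f = (\<lambda>N::nat. real N * ln (real N) / ln (ln (real N)))"
  have "eventually (\<lambda>N. finite (distance_set nrm N S) \<longrightarrow>
      c / 52 * f N \<le> card (distance_set nrm N S)) sequentially"
    using growth_from_log_bound[OF c] filterlim_real_sequentially[unfolded filterlim_at_top, rule_format, of N0]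
  proof eventually_elim
    case (elim N)
    thus ?case unfolding f_def using bound by blast
  qed
  then obtain M where M: "\<And>N. N \<ge> M \<Longrightarrow> finite (distance_set nrm N S) \<Longrightarrow>
      c / 52 * f N \<le> card (distance_set nrm N S)"
    unfolding eventually_sequentially by blast
  \<comment> \<open>Only finitely many \<open>N\<close> lie below the threshold \<open>M\<close>. If
    such an \<open>N\<close> is at least \<open>3\<close>, then \<open>f N \<le> T\<close>, so
    \<open>c' * f N \<le> 1\<close>, and a finite distance set has at least one element because it
    contains \<open>0\<close>. The summand \<open>1\<close> keeps \<open>T\<close> positive.\<close>
  define T where "T = 1 + (\<Sum>N<M. \<bar>f N\<bar>)"
  have "T > 0" unfolding T_def by (intro add_pos_nonneg sum_nonneg) auto
  define c' where "c' = min (c / 52) (1 / T)"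
  have "c' > 0" using c \<open>T > 0\<close> by (simp add: c'_def)
  have "c' * f N \<le> card (distance_set nrm N S)" if N: "N \<ge> 3" and fin: "finite (distance_set nrm N S)" for N
  proof -
    have "ln (real N) > 1"
    proof -
      have "exp 1 < real N" using N e_less_272 by linarith
      hence "ln (exp 1) < ln (real N)" using N by (subst ln_less_cancel_iff) auto
      thus ?thesis by simp
    qed
    hence "f N \<ge> 0" by (simp add: f_def)
    show ?thesis
    proof (cases "N \<ge> M")
      case True
      have "c' * f N \<le> c / 52 * f N" using \<open>f N \<ge> 0\<close> by (intro mult_right_mono) (auto simp: c'_def)
      also note M[OF True fin]
      finally show ?thesis .
    next
      case False
      have "f N \<le> \<bar>f N\<bar>" by simp
      also have "\<dots> \<le> (\<Sum>N<M. \<bar>f N\<bar>)" using False by (intro member_le_sum) auto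
      finally have "f N \<le> T" by (simp add: T_def)
      have "c' * f N \<le> 1 / T * T"
        using \<open>f N \<le> T\<close> \<open>f N \<ge> 0\<close> \<open>T > 0\<close> by (intro mult_mono) (auto simp: c'_def)
      also have "\<dots> = 1" using \<open>T > 0\<close> by simp
      also have "\<dots> \<le> real (card (distance_set nrm N S))"
      proof -
        have "nrm (s 0 - s 0) \<in> distance_set nrm N S"
          using s(1) unfolding distance_set_def by force
        hence "card (distance_set nrm N S) > 0" using fin by (auto simp: card_gt_0_iff)
        thus ?thesis by simp
      qed
      finally show ?thesis .
    qed
  qed
  \<comment> \<open>For an infinite distance set \<open>ecard\<close> is \<open>\<infinity>\<close>,
    so the finite case is all that remains.\<close>
  thus ?thesis using \<open>c' > 0\<close>
    by (intro exI[of _ c']) (auto simp: ecard_def f_def)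
qed

end
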